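(* Every natural number $n\in\mathbb{N}=\{0,1,2,\ldots\}$ can be written in each of the following five forms with $x,y,z\in\mathbb{Z}$: $$x^2+3y^2+t_z,\quad x^2+3t_y+t_z,\quad x^2+6t_y+t_z,\quad 3x^2+2t_y+t_z,\quad 4x^2+2t_y+t_z.$$ That is, for each of these five forms separately, there exist integers $x,y,z$ (depending on $n$ and the form) such that $n$ equals that expression.
   Context: For $x\in\mathbb{Z}$, $t_x$ denotes the triangular number $t_x=x(x+1)/2$. *)

theory Defs
  imports Main
begin

text \<open>Triangular number t_x = x(x+1)/2 for integer x (x(x+1) is always even, so div is exact).\<close>
definition tri :: "int \<Rightarrow> int" where
  "tri x = x * (x + 1) div 2"

end

theory Submission
  imports
    Defs
    "HOL-Number_Theory.Number_Theory"
    "HOL-Number_Theory.Prime_Powers"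
    "HOL-Computational_Algebra.Squarefree"
    "HOL-Library.Discrete_Functions"
begin

text \<open>
  Everything reduces to the three-square theorem. If 3 m is a sum of three squares, the signs can be
  chosen such that all three roots agree modulo 3, and then m = x^2 + 2 (u^2 + u v + v^2), that is,
  m = x^2 + 2 y^2 + 6 z^2. Hence this form represents 8 n + 1, 8 n + 3, 8 n + 7 and 4 n + 2, and
  parity considerations turn these representations into the first four claims. For the fifth, write
  8 n + 3 as a sum of three odd squares; after a choice of signs two of the roots agree modulo 8.

  For the three-square theorem let N be squarefree. One chooses a prime q = 1 (mod 4) with prescribed
  Legendre symbols at the prime divisors of N such that, for D = q or D = 2 q, the equation
  x^2 + D y^2 = N w^2 is solvable by a pigeonhole argument. As D is a sum of two squares, N is a sum of
  three rational squares, hence of three integral ones by the descent of Davenport and Cassels.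

  The prime q exists by Dirichlet's method, where only real characters are needed: L(1, chi) is
  nonzero by the hyperbola method, so the sums of chi(n) Lambda(n) / n stay bounded, whereas those of
  Lambda(n) / n do not.
\<close>

section \<open>Sums of the von Mangoldt function and of inverse square roots\<close>

text \<open>The numbers 8 n + 1, 8 n + 3, 8 n + 7 and 4 n + 2 come from completing squares: 8 t_z +
  1 = (2 z + 1)^2, so n = x^2 + 6 t_y + t_z, for instance, means 8 n + 7 = (2 z + 1)^2 + 2 (2 x)^2 +
  6 (2 y + 1)^2. The factor 3 moves them into classes modulo 8 in which three squares exist, and
  divisibility by 3 is what aligns the roots. Real characters suffice because every condition on q
  is a sign: its class among 1 and 5 modulo 8, and its Legendre symbols. The condition q = 1 (mod 4)
  does two jobs: it makes q and 2 q sums of two squares, and it removes the sign from quadratic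
  reciprocity. The choice between D = q and D = 2 q answers an obstacle. If -q is a residue modulo
  every prime divisor of an odd squarefree N, reciprocity forces (N/q) to be \<open>chi4 N\<close>,
  which is -1 for N = 3 (mod 4). The factor 2 brings in \<open>chi8 N\<close> and rescues the class
  3 modulo 8, but not 7.\<close>

lemma sum_divisors_swap:
  fixes h :: "nat \<Rightarrow> nat \<Rightarrow> 'a :: comm_monoid_add"
  shows "(\<Sum>n=1..N. \<Sum>d | d dvd n. h d (n div d)) = (\<Sum>d=1..N. \<Sum>m=1..N div d. h d m)"
proof -
  have "(\<Sum>n=1..N. \<Sum>d | d dvd n. h d (n div d)) =
        (\<Sum>(n,d)\<in>(SIGMA n:{1..N}. {d. d dvd n}). h d (n div d))"
    by (intro sum.Sigma) auto
  also have "\<dots> = (\<Sum>(d,m)\<in>(SIGMA d:{1..N}. {1..N div d}). h d m)"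
    by (intro sum.reindex_bij_witness[of _ "\<lambda>(d,m). (d * m, d)" "\<lambda>(n,d). (d, n div d)"])
       (auto simp: less_eq_div_iff_mult_less_eq mult.commute div_le_mono
          intro: Suc_leI dvd_pos_nat dest: dvd_imp_le elim!: dvdE,
        metis One_nat_def dual_order.trans less_eq_nat.simps(1) mult.right_neutral mult_le_mono2)
  also have "\<dots> = (\<Sum>d=1..N. \<Sum>m=1..N div d. h d m)"
    by (intro sum.Sigma [symmetric]) auto
  finally show ?thesis .
qed

text \<open>Abel summation. Only the first value \<open>f a\<close> enters the bound, so with a
  variable starting point it controls tails as well as whole sums.\<close>

lemma abs_sum_mult_antimono_le:
  fixes c f :: "nat \<Rightarrow> real"
  assumes bound: "\<And>b. \<bar>\<Sum>n\<in>{a..<b}. c n\<bar> \<le> B"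
    and nonneg: "\<And>n. n \<ge> a \<Longrightarrow> f n \<ge> 0"
    and antimono: "\<And>n. n \<ge> a \<Longrightarrow> f (Suc n) \<le> f n"
  shows "\<bar>\<Sum>n\<in>{a..<b}. c n * f n\<bar> \<le> B * f a"
proof (cases "a \<le> b")
  case True
  define T where "T b = (\<Sum>n\<in>{a..<b}. c n)" for b
  have parts: "(\<Sum>n\<in>{a..<b}. c n * f n) =
               T b * f b + (\<Sum>n\<in>{a..<b}. T (Suc n) * (f n - f (Suc n)))"
    using True
    by (induction b rule: dec_induct) (auto simp: T_def algebra_simps)
  have "\<bar>\<Sum>n\<in>{a..<b}. T (Suc n) * (f n - f (Suc n))\<bar> \<le> (\<Sum>n\<in>{a..<b}. B * (f n - f (Suc n)))"
  proof (intro sum_abs [THEN order_trans] sum_mono)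
    fix n assume "n \<in> {a..<b}"
    then show "\<bar>T (Suc n) * (f n - f (Suc n))\<bar> \<le> B * (f n - f (Suc n))"
      using bound [of "Suc n"] antimono [of n] unfolding T_def abs_mult
      by (intro mult_mono) auto
  qed
  also have "\<dots> = B * (f a - f b)"
    using True by (simp add: sum_distrib_left [symmetric] sum_Suc_diff' [of a b "\<lambda>n. - f n", simplified])
  finally have "\<bar>\<Sum>n\<in>{a..<b}. T (Suc n) * (f n - f (Suc n))\<bar> \<le> B * (f a - f b)" .
  moreover have "\<bar>T b * f b\<bar> \<le> B * f b"
    using bound [of b] nonneg [OF True] by (auto simp: T_def abs_mult intro!: mult_right_mono)
  ultimately show ?thesis
    unfolding parts by (simp add: algebra_simps)
next
  case False
  have "B \<ge> 0" using bound [of a] by simp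
  with False show ?thesis using nonneg [of a] by simp
qed

lemma ln_Suc_le_sum_inverse: "ln (real (Suc N)) \<le> (\<Sum>m=1..N. 1 / real m)"
proof (induction N)
  case (Suc N)
  have "ln (real (Suc (Suc N))) \<le> ln (real (Suc N)) + 1 / real (Suc N)"
    using ln_diff_le [of "real (Suc (Suc N))" "real (Suc N)"] by simp
  also have "\<dots> \<le> (\<Sum>m=1..Suc N. 1 / real m)" using Suc by simp
  finally show ?case .
qed auto

lemma sqrt_Suc_diff: "sqrt (real (Suc n)) - sqrt (real n) = 1 / (sqrt (real (Suc n)) + sqrt (real n))"
proof -
  have "(sqrt (real (Suc n)) - sqrt (real n)) * (sqrt (real (Suc n)) + sqrt (real n)) = 1"
    by (simp add: algebra_simps flip: power2_eq_square)
  moreover have "sqrt (real (Suc n)) + sqrt (real n) > 0"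
    by (intro add_pos_nonneg) auto
  ultimately show ?thesis by (simp add: field_simps)
qed

lemma sum_inverse_sqrt_le: "(\<Sum>b=1..n. 1 / sqrt (real b)) \<le> 2 * sqrt (real n)"
proof (induction n)
  case (Suc n)
  have "1 / (sqrt (real (Suc n)) + sqrt (real n)) \<ge> 1 / (sqrt (real (Suc n)) + sqrt (real (Suc n)))"
    by (intro divide_left_mono add_left_mono mult_pos_pos add_pos_nonneg) auto
  then show ?case using Suc sqrt_Suc_diff [of n] by simp
qed auto

text \<open>The constant, zeta(1/2), is enclosed between the decreasing sequence \<open>u\<close>
  and the increasing sequence \<open>v\<close>, whose distance is exactly the claimed error.\<close>

lemma sum_inverse_sqrt_asymp:
  obtains c :: real where
    "\<And>n. n \<ge> 1 \<Longrightarrow> \<bar>(\<Sum>b=1..n. 1 / sqrt (real b)) - 2 * sqrt (real n) - c\<bar> \<le> 1 / sqrt (real n)"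
proof -
  define u where "u n = (\<Sum>b=1..n. 1 / sqrt (real b)) - 2 * sqrt (real n)" for n
  \<comment> \<open>The shift avoids the index 0: with 1 / sqrt 0 = 0, the sequence u n - 1 / sqrt n
    would start by decreasing.\<close>
  define v where "v n = u (Suc n) - 1 / sqrt (real (Suc n))" for n
  have step: "u (Suc n) - u n = 1 / sqrt (real (Suc n)) - 2 / (sqrt (real (Suc n)) + sqrt (real n))" for n
    using sqrt_Suc_diff [of n] by (simp add: u_def)
  have u_dec: "u (Suc n) \<le> u n" for n
  proof -
    have "2 / (sqrt (real (Suc n)) + sqrt (real n)) \<ge> 2 / (sqrt (real (Suc n)) + sqrt (real (Suc n)))"
      by (intro divide_left_mono add_left_mono mult_pos_pos add_pos_nonneg) auto
    then show ?thesis using step [of n] by simp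
  qed
  have "v n \<le> v (Suc n)" for n
  proof -
    have "2 / (sqrt (real (Suc (Suc n))) + sqrt (real (Suc n))) \<le> 2 / (sqrt (real (Suc n)) + sqrt (real (Suc n)))"
      by (intro divide_left_mono add_right_mono mult_pos_pos add_pos_nonneg) auto
    then show ?thesis using step [of "Suc n"] by (simp add: v_def)
  qed
  then have "incseq v" by (rule incseq_SucI)
  have dec: "decseq u" using u_dec by (rule decseq_SucI)
  have v_le: "v m \<le> u n" if "Suc m \<ge> n" for m n
    using decseqD [OF dec that] by (auto simp: v_def intro: order_trans [of _ "u (Suc m)"])
  obtain c where c: "v \<longlonglongrightarrow> c" "\<And>i. v i \<le> c"
    using incseq_convergent [OF \<open>incseq v\<close>, of "u 0"] v_le [of 0] by blast
  show ?thesis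
  proof
    fix n :: nat assume n: "n \<ge> 1"
    have "c \<le> u n"
      using v_le [of n] by (intro LIMSEQ_le_const2 [OF c(1)] exI [of _ n]) auto
    moreover have "u n - 1 / sqrt (real n) \<le> c"
      using c(2) [of "n - 1"] n by (simp add: v_def)
    ultimately show "\<bar>(\<Sum>b=1..n. 1 / sqrt (real b)) - 2 * sqrt (real n) - c\<bar> \<le> 1 / sqrt (real n)"
      by (simp add: u_def)
  qed
qed

text \<open>Rounding m / a down to an integer costs little. With y = m / a and n its integer part, 2
  (sqrt y - sqrt n) and the old error 1 / sqrt n are each at most 2 / sqrt y, which gives the
  4.\<close>

lemma sum_inverse_sqrt_div_asymp:
  obtains c :: real where
    "\<And>m a. 1 \<le> a \<Longrightarrow> a \<le> m \<Longrightarrow>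
       \<bar>(\<Sum>b=1..m div a. 1 / sqrt (real b)) - 2 * sqrt (real m / real a) - c\<bar> \<le> 4 / sqrt (real m / real a)"
proof -
  obtain c where c: "\<And>n. n \<ge> 1 \<Longrightarrow>
      \<bar>(\<Sum>b=1..n. 1 / sqrt (real b)) - 2 * sqrt (real n) - c\<bar> \<le> 1 / sqrt (real n)"
    using sum_inverse_sqrt_asymp by blast
  show ?thesis
  proof
    fix m a :: nat assume a: "1 \<le> a" "a \<le> m"
    define n where "n = m div a"
    define y where "y = real m / real a"
    have n1: "n \<ge> 1" using a by (simp add: n_def less_eq_div_iff_mult_less_eq)
    have ny: "real n \<le> y" unfolding n_def y_def by (rule of_nat_div_le_of_nat)
    have "m < a * (n + 1)"
      unfolding n_def using a by (metis Suc_eq_plus1 dividend_less_times_div less_le_trans mult_Suc_right zero_less_one add.commute)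
    then have "real m < real a * (real n + 1)"
      by (metis of_nat_less_iff of_nat_mult of_nat_add of_nat_1)
    then have yn: "y < real n + 1" using a by (simp add: y_def field_simps)
    have y1: "y \<ge> 1" using n1 ny by linarith
    have sq: "(sqrt y - sqrt (real n)) * (sqrt y + sqrt (real n)) = y - real n"
      using y1 by (simp add: algebra_simps flip: power2_eq_square)
    have "(sqrt y - sqrt (real n)) * sqrt y \<le> (sqrt y - sqrt (real n)) * (sqrt y + sqrt (real n))"
      using ny by (intro mult_left_mono) auto
    also have "\<dots> \<le> 1" using sq yn by simp
    finally have d: "sqrt y - sqrt (real n) \<le> 1 / sqrt y" using y1 by (simp add: field_simps)
    have "y \<le> 4 * real n" using yn n1 by linarith
    then have "sqrt y \<le> sqrt (4 * real n)" by (rule real_sqrt_le_mono)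
    then have "sqrt y \<le> 2 * sqrt (real n)" by (simp add: real_sqrt_mult)
    then have e: "1 / sqrt (real n) \<le> 2 / sqrt y" using y1 n1 by (simp add: field_simps)
    have "sqrt (real n) \<le> sqrt y" using ny by simp
    with c [OF n1] d e show "\<bar>(\<Sum>b=1..m div a. 1 / sqrt (real b)) - 2 * sqrt (real m / real a) - c\<bar>
        \<le> 4 / sqrt (real m / real a)"
      unfolding n_def [symmetric] y_def [symmetric] by (simp only: abs_le_iff) linarith
  qed
qed

section \<open>Chebyshev's upper bound and Mertens' lower bound, both from the factorisation of
  N!\<close>

lemma ln_fact_eq_sum_mangoldt: "ln (fact N :: real) = (\<Sum>d=1..N. mangoldt d * real (N div d))"
proof -
  have "ln (fact N :: real) = (\<Sum>n=1..N. ln (real n))"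
    by (induction N) (auto simp: ln_mult simp del: of_nat_Suc)
  also have "\<dots> = (\<Sum>n=1..N. \<Sum>d | d dvd n. mangoldt d)"
    by (intro sum.cong refl) (auto simp: mangoldt_sum)
  also have "\<dots> = (\<Sum>d=1..N. mangoldt d * real (N div d))"
    using sum_divisors_swap [of "\<lambda>d _. mangoldt d :: real" N] by (simp add: mult.commute)
  finally show ?thesis .
qed

text \<open>The number \<open>2 * n div d\<close> - 2 (\<open>n div d\<close>) is never negative and
  is at least 1 for n < d <= 2 n. Summed against \<open>mangoldt\<close> it gives the logarithm of
  the central binomial coefficient, which is at most 4^n.\<close>

lemma sum_mangoldt_double:
  "(\<Sum>d=1..2*n. mangoldt d) \<le> (\<Sum>d=1..n. mangoldt d) + real n * ln 4"
proof -
  have "(\<Sum>d=1..2*n. mangoldt d) = (\<Sum>d=1..n. mangoldt d) + (\<Sum>d=n+1..2*n. mangoldt d :: real)"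
    using sum.ub_add_nat [of 1 n "mangoldt :: nat \<Rightarrow> real" n] by (simp add: mult_2)
  moreover have "(\<Sum>d=n+1..2*n. mangoldt d) \<le> real n * ln 4"
  proof -
    have "(\<Sum>d=n+1..2*n. mangoldt d) \<le>
          (\<Sum>d=n+1..2*n. mangoldt d * (real (2 * n div d) - 2 * real (n div d)))"
    proof (intro sum_mono)
      fix d assume "d \<in> {n+1..2*n}"
      then have "n div d = 0" "2 * n div d \<ge> 1" by (auto simp: less_eq_div_iff_mult_less_eq)
      then have "1 \<le> real (2 * n div d) - 2 * real (n div d)" by simp
      from mult_left_mono [OF this mangoldt_nonneg [of d]]
      show "mangoldt d \<le> mangoldt d * (real (2 * n div d) - 2 * real (n div d))" by simp
    qed
    also have "\<dots> \<le> (\<Sum>d=1..2*n. mangoldt d * (real (2 * n div d) - 2 * real (n div d)))"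
    proof (intro sum_mono2 mult_nonneg_nonneg mangoldt_nonneg)
      fix d
      have "2 * (n div d) \<le> 2 * n div d"
        by (cases "d = 0") (auto simp: less_eq_div_iff_mult_less_eq)
      then have "real (2 * (n div d)) \<le> real (2 * n div d)" by (rule of_nat_mono)
      then show "0 \<le> real (2 * n div d) - 2 * real (n div d)" by simp
    qed auto
    also have "\<dots> = ln (fact (2 * n)) - 2 * (\<Sum>d=1..2*n. mangoldt d * real (n div d))"
      by (simp add: ln_fact_eq_sum_mangoldt algebra_simps sum_subtractf sum_distrib_left)
    also have "(\<Sum>d=1..2*n. mangoldt d * real (n div d)) = ln (fact n)"
      unfolding ln_fact_eq_sum_mangoldt by (intro sum.mono_neutral_right) auto
    also have "ln (fact (2 * n)) - 2 * ln (fact n) = ln (real (2 * n choose n))"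
    proof -
      have "ln (real (2 * n choose n) * (fact n * fact n)) = ln (fact (2 * n))"
        using binomial_fact_lemma [of n "2 * n"]
        by (metis (mono_tags, lifting) add_diff_cancel_left' le_add1 mult_2 mult.commute of_nat_fact of_nat_mult)
      then show ?thesis by (simp add: ln_mult_pos)
    qed
    also have "\<dots> \<le> ln (4 ^ n)"
    proof -
      have "2 * n choose n \<le> 2 ^ (2 * n)" by (rule binomial_le_pow2)
      then have "real (2 * n choose n) \<le> 2 ^ (2 * n)"
        by (metis of_nat_le_iff of_nat_numeral of_nat_power)
      then show ?thesis by (simp add: power_mult)
    qed
    also have "\<dots> = real n * ln 4" by (simp add: ln_realpow)
    finally show ?thesis .
  qed
  ultimately show ?thesis by simp
qed

text \<open>Repeated halving of n. The factor 2 pays for rounding odd n up: 3 (m + 1) <= 4 m + 2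
  holds from m = 1 on.\<close>

lemma sum_mangoldt_le: "(\<Sum>d=1..n. mangoldt d :: real) \<le> 2 * ln 4 * real n"
proof (induction n rule: less_induct)
  case (less n)
  have l: "ln 4 > (0::real)" by simp
  consider "n = 0" | "n = 1" | m where "n = 2 * m" "m \<ge> 1" | m where "n = 2 * m + 1" "m \<ge> 1"
    by (metis One_nat_def Suc_leI add_0 evenE mult_0_right neq0_conv oddE)
  then show ?case
  proof cases
    case 3
    have "(\<Sum>d=1..n. mangoldt d :: real) \<le> (\<Sum>d=1..m. mangoldt d) + real m * ln 4"
      unfolding 3 by (rule sum_mangoldt_double)
    also have "\<dots> \<le> 2 * ln 4 * real m + real m * ln 4" using less [of m] 3 by (simp add: mult_ac)
    also have "\<dots> \<le> 2 * ln 4 * real n" using 3 l by (simp add: field_simps)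
    finally show ?thesis .
  next
    case 4
    have "(\<Sum>d=1..n. mangoldt d :: real) \<le> (\<Sum>d=1..2*(m+1). mangoldt d)"
      unfolding 4 by (intro sum_mono2) (auto simp: mangoldt_nonneg)
    also have "\<dots> \<le> (\<Sum>d=1..m+1. mangoldt d) + real (m + 1) * ln 4"
      by (rule sum_mangoldt_double)
    also have "\<dots> \<le> 2 * ln 4 * real (m + 1) + real (m + 1) * ln 4" using less [of "m + 1"] 4 by (simp add: mult_ac)
    also have "\<dots> = ln 4 * (3 * real m + 3)" by (simp add: algebra_simps)
    also have "\<dots> \<le> ln 4 * (4 * real m + 2)" using 4 l by (intro mult_left_mono) auto
    also have "\<dots> = 2 * ln 4 * real n" using 4 by (simp add: algebra_simps)
    finally show ?thesis .
  qed (use l in auto)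
qed

text \<open>N! is at least (N / e)^N, while dropping the rounding in \<open>N div d\<close> can only
  increase the expansion of ln N!. This is the divergence on which the existence of primes
  rests.\<close>

lemma sum_mangoldt_div_ge: 
  assumes "N \<ge> 1" shows "ln (real N) - 1 \<le> (\<Sum>d=1..N. mangoldt d / real d)"
proof -
  have "real N * ln (real N) - real N \<le> ln (fact N)"
    using assms
  proof (induction N rule: dec_induct)
    case (step N)
    have *: "real N * (ln (real (Suc N)) - ln (real N)) \<le> 1"
      using ln_diff_le [of "real (Suc N)" "real N"] step.hyps by (simp add: field_simps)
    have "ln (fact (Suc N) :: real) = ln (real (Suc N)) + ln (fact N)"
      by (simp add: ln_mult del: of_nat_Suc)
    then show ?case using step.IH * by (simp add: algebra_simps)
  qed auto
  also have "ln (fact N :: real) \<le> (\<Sum>d=1..N. mangoldt d * (real N / real d))"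
    unfolding ln_fact_eq_sum_mangoldt
    by (intro sum_mono mult_left_mono mangoldt_nonneg of_nat_div_le_of_nat)
  also have "\<dots> = real N * (\<Sum>d=1..N. mangoldt d / real d)"
    by (simp add: sum_distrib_left mult_ac)
  finally have "real N * (ln (real N) - 1) \<le> real N * (\<Sum>d=1..N. mangoldt d / real d)"
    by (simp add: algebra_simps)
  then show ?thesis using assms by simp
qed

section \<open>Real characters\<close>

text \<open>A real Dirichlet character, with \<open>sum_period\<close> expressing that it is not
  principal. M need not be the conductor, and the values off the units modulo M need not be 0, so
  products of characters of different conductors can share one M.\<close>

locale real_character =
  fixes \<chi> :: "nat \<Rightarrow> real" and M :: nat
  assumes modulus_pos: "M > 0"
    and periodic: "\<chi> (n + M) = \<chi> n"
    and mult: "\<chi> (a * b) = \<chi> a * \<chi> b"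
    and one: "\<chi> 1 = 1"
    and value_cases: "\<chi> n \<in> {-1, 0, 1}"
    and sum_period: "(\<Sum>n<M. \<chi> n) = 0"
begin

lemma abs_le_1: "\<bar>\<chi> n\<bar> \<le> 1"
  using value_cases [of n] by auto

text \<open>Since a full period sums to 0, the initial sums are periodic and bounded by M. A sum
  over an interval is a difference of two of them.\<close>

lemma abs_sum_le: "\<bar>\<Sum>n\<in>{a..<b}. \<chi> n\<bar> \<le> 2 * real M"
proof -
  define S where "S n = (\<Sum>k<n. \<chi> k)" for n
  have shift: "S (n + M) = S n" for n
    by (induction n) (auto simp: S_def sum_period periodic)
  have "S (n + M * k) = S n" for n k
    by (induction k) (auto simp: shift algebra_simps, metis shift add.assoc add.commute)
  then have "S n = S (n mod M)" for n
    by (metis mod_mult_div_eq)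
  moreover have "\<bar>S (n mod M)\<bar> \<le> real M" for n
  proof -
    have "\<bar>S (n mod M)\<bar> \<le> (\<Sum>k<n mod M. 1)"
      unfolding S_def by (intro sum_abs [THEN order_trans] sum_mono abs_le_1)
    also have "\<dots> \<le> real M" using modulus_pos by (simp add: less_imp_le)
    finally show ?thesis .
  qed
  ultimately have S: "\<bar>S n\<bar> \<le> real M" for n by metis
  show ?thesis
  proof (cases "a \<le> b")
    case True
    then have "(\<Sum>n\<in>{a..<b}. \<chi> n) = S b - S a"
      unfolding S_def by (metis sum_diff_nat_ivl atLeast0LessThan zero_le)
    with S [of a] S [of b] show ?thesis by linarith
  qed auto
qed

lemma abs_sum_mult_le:
  assumes "\<And>n. n \<ge> a \<Longrightarrow> f n \<ge> 0" "\<And>n. n \<ge> a \<Longrightarrow> f (Suc n) \<le> f n"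
  shows "\<bar>\<Sum>n\<in>{a..b}. \<chi> n * f n\<bar> \<le> 2 * real M * f a"
  using abs_sum_mult_antimono_le [where c = \<chi> and b = "Suc b" and f = f and a = a, OF abs_sum_le assms]
  by (simp add: atLeastLessThanSuc_atLeastAtMost)

text \<open>Abel's bound for tails makes the partial sums Cauchy and survives the limit. The
  explicit rate matters because it will be used at \<open>N div d\<close> with d ranging up to
  N.\<close>

lemma sum_mult_converges:
  assumes nonneg: "\<And>n. n \<ge> 1 \<Longrightarrow> f n \<ge> 0" and anti: "\<And>n. n \<ge> 1 \<Longrightarrow> f (Suc n) \<le> f n"
    and lim: "f \<longlonglongrightarrow> 0"
  obtains L where "\<And>N. \<bar>(\<Sum>n=1..N. \<chi> n * f n) - L\<bar> \<le> 2 * real M * f (Suc N)"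
proof -
  define s where "s N = (\<Sum>n=1..N. \<chi> n * f n)" for N
  have diff: "\<bar>s n - s m\<bar> \<le> 2 * real M * f (Suc n)" if "n \<le> m" for m n
  proof -
    have "s m = s n + (\<Sum>k=Suc n..m. \<chi> k * f k)"
      using that sum.ub_add_nat [of 1 n "\<lambda>k. \<chi> k * f k" "m - n"] by (simp add: s_def)
    then show ?thesis using abs_sum_mult_le [of "Suc n" f m] nonneg anti by simp
  qed
  have f0: "(\<lambda>n. 2 * real M * f (Suc n)) \<longlonglongrightarrow> 0"
    using tendsto_mult_right_zero [OF LIMSEQ_Suc [OF lim]] .
  have "Cauchy s"
  proof (rule CauchyI')
    fix e :: real assume "e > 0"
    then obtain N where N: "\<And>n. n \<ge> N \<Longrightarrow> \<bar>2 * real M * f (Suc n)\<bar> < e"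
      using LIMSEQ_D [OF f0] by (auto simp: real_norm_def)
    show "\<exists>M. \<forall>m\<ge>M. \<forall>n>m. dist (s m) (s n) < e"
    proof (intro exI [of _ N] allI impI)
      fix m n assume "m \<ge> N" "n > m"
      then have "\<bar>s m - s n\<bar> < e" using diff [of m n] N [of m] by linarith
      then show "dist (s m) (s n) < e" by (simp add: dist_real_def)
    qed
  qed
  then obtain L where L: "s \<longlonglongrightarrow> L"
    using real_Cauchy_convergent convergent_def by blast
  show ?thesis
  proof
    fix N
    have "(\<lambda>m. \<bar>s N - s m\<bar>) \<longlonglongrightarrow> \<bar>s N - L\<bar>"
      by (intro tendsto_intros L)
    then have "\<bar>s N - L\<bar> \<le> 2 * real M * f (Suc N)"
      using diff [of N] by (intro LIMSEQ_le_const2 [OF _ exI [of _ N]]) auto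
    then show "\<bar>(\<Sum>n=1..N. \<chi> n * f n) - L\<bar> \<le> 2 * real M * f (Suc N)"
      by (simp add: s_def)
  qed
qed

section \<open>Divisor sums of chi\<close>

lemma power: "\<chi> (a ^ k) = \<chi> a ^ k"
  by (induction k) (auto simp: mult one [simplified])

text \<open>The divisors of p^k m are p^i d, uniquely, with i <= k and d dividing m. Splitting off
  one prime at a time drives the next two inductions.\<close>

lemma sum_divisors_prime_power_mult:
  assumes p: "prime p" and m: "\<not> p dvd m" "m > 0"
  shows "(\<Sum>d | d dvd p ^ k * m. \<chi> d) = (\<Sum>i\<le>k. \<chi> p ^ i) * (\<Sum>d | d dvd m. \<chi> d)"
proof -
  have "inj_on (\<lambda>(i, d). p ^ i * d) ({..k} \<times> {d. d dvd m})"
  proof (rule inj_onI, clarify)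
    fix i d j e assume *: "p ^ i * d = p ^ j * e" "d dvd m" "e dvd m"
    then have "\<not> p dvd d" "\<not> p dvd e" "d \<noteq> 0" "e \<noteq> 0"
      using m by (auto dest: dvd_trans intro!: Nat.gr0I)
    then have "multiplicity p (p ^ i * d) = i" "multiplicity p (p ^ j * e) = j"
      using p by (auto intro!: multiplicity_eqI simp: prime_gt_0_nat)
    then have "i = j" using * by simp
    with * p show "i = j \<and> d = e" by (auto dest: prime_gt_0_nat)
  qed
  moreover have "(\<lambda>(i, d). p ^ i * d) ` ({..k} \<times> {d. d dvd m}) = {d. d dvd p ^ k * m}"
  proof (intro equalityI subsetI)
    fix d assume "d \<in> {d. d dvd p ^ k * m}"
    then obtain b c where bc: "d = b * c" "b dvd p ^ k" "c dvd m"
      by (auto elim: dvd_productE)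
    then obtain i where "i \<le> k" "b = p ^ i" using divides_primepow_nat [OF p] by blast
    with bc show "d \<in> (\<lambda>(i, d). p ^ i * d) ` ({..k} \<times> {d. d dvd m})" by auto
  qed (auto intro: mult_dvd_mono le_imp_power_dvd)
  ultimately have "(\<Sum>d | d dvd p ^ k * m. \<chi> d) =
      (\<Sum>(i, d)\<in>{..k} \<times> {d. d dvd m}. \<chi> (p ^ i * d))"
    by (metis (mono_tags, lifting) sum.reindex_cong case_prod_unfold)
  also have "\<dots> = (\<Sum>i\<le>k. \<Sum>d | d dvd m. \<chi> p ^ i * \<chi> d)"
    using m by (subst sum.cartesian_product) (auto simp: mult power)
  finally show ?thesis by (simp add: sum_product)
qed

text \<open>For the value -1 the sum alternates between 1 and 0, being 1 when the top exponent is
  even. For the value 0 the term 0 ^ 0 = 1 remains.\<close>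

lemma sum_powers_nonneg: "(\<Sum>i\<le>k. \<chi> p ^ i) \<ge> 0"
  and sum_even_powers_ge_1: "(\<Sum>i\<le>2*k. \<chi> p ^ i) \<ge> 1"
proof -
  have *: "(\<Sum>i\<le>k. (-1::real) ^ i) = (if even k then 1 else 0)" for k
    by (induction k) auto
  show "(\<Sum>i\<le>k. \<chi> p ^ i) \<ge> 0"
    using value_cases [of p] by (auto simp: * sum_nonneg)
  have "(\<Sum>i\<le>2*k. (0::real) ^ i) = 1" by (simp add: power_0_left)
  then show "(\<Sum>i\<le>2*k. \<chi> p ^ i) \<ge> 1"
    using value_cases [of p] by (auto simp: *)
qed

lemma sum_divisors_nonneg:
  assumes "n > 0" shows "(\<Sum>d | d dvd n. \<chi> d) \<ge> 0"
  using assms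
proof (induction n rule: less_induct)
  case (less n)
  show ?case
  proof (cases "n = 1")
    case False
    then obtain p where p: "prime p" "p dvd n" using prime_factor_nat by blast
    obtain m where m: "n = p ^ multiplicity p n * m" "\<not> p dvd m"
      using multiplicity_decompose' [of n p] p less.prems by (metis not_prime_unit neq0_conv)
    have "m > 0" using m less.prems by (auto intro!: Nat.gr0I)
    moreover have "m < n"
    proof -
      have "m dvd n" using m(1) by (metis dvd_triv_right)
      then have "m \<le> n" using less.prems by (rule dvd_imp_le)
      then show ?thesis using m(2) p(2) by (cases "m = n") auto
    qed
    ultimately have "(\<Sum>d | d dvd m. \<chi> d) \<ge> 0" by (rule less.IH [rotated])
    then show ?thesis
      using sum_divisors_prime_power_mult [OF p(1) m(2) \<open>m > 0\<close>, of "multiplicity p n"] m(1)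
        sum_powers_nonneg [of p "multiplicity p n"] by simp
  qed (use one in simp)
qed

text \<open>A square has only even exponents, so every local factor is at least 1. These terms will
  supply a harmonic series.\<close>

lemma sum_divisors_square_ge_1:
  assumes "n > 0" shows "(\<Sum>d | d dvd n\<^sup>2. \<chi> d) \<ge> 1"
  using assms
proof (induction n rule: less_induct)
  case (less n)
  show ?case
  proof (cases "n = 1")
    case False
    then obtain p where p: "prime p" "p dvd n" using prime_factor_nat by blast
    obtain m where m: "n = p ^ multiplicity p n * m" "\<not> p dvd m"
      using multiplicity_decompose' [of n p] p less.prems by (metis not_prime_unit neq0_conv)
    have m0: "m > 0" using m less.prems by (auto intro!: Nat.gr0I)
    moreover have "m < n"
    proof -
      have "m dvd n" using m(1) by (metis dvd_triv_right)
      then have "m \<le> n" using less.prems by (rule dvd_imp_le)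
      then show ?thesis using m(2) p(2) by (cases "m = n") auto
    qed
    ultimately have IH: "(\<Sum>d | d dvd m\<^sup>2. \<chi> d) \<ge> 1" by (rule less.IH [rotated])
    have "\<not> p dvd m\<^sup>2" "m\<^sup>2 > 0" using m(2) p(1) m0 by (auto simp: prime_dvd_power_iff)
    then have "(\<Sum>d | d dvd p ^ (2 * multiplicity p n) * m\<^sup>2. \<chi> d) =
        (\<Sum>i\<le>2*multiplicity p n. \<chi> p ^ i) * (\<Sum>d | d dvd m\<^sup>2. \<chi> d)"
      by (rule sum_divisors_prime_power_mult [OF p(1)])
    moreover have "n\<^sup>2 = p ^ (2 * multiplicity p n) * m\<^sup>2"
      by (subst m(1)) (simp add: power_mult_distrib power_mult [symmetric] mult.commute)
    ultimately show ?thesis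
      using mult_mono [OF sum_even_powers_ge_1 [of p "multiplicity p n"] IH] sum_powers_nonneg [of p "2 * multiplicity p n"]
      by simp
  qed (use one in simp)
qed

section \<open>Nonvanishing of L(1, chi)\<close>

lemma hyperbola_tail_le:
  assumes N: "N \<ge> 1"
  shows "(\<Sum>b=1..N. \<Sum>a=N+1..N\<^sup>2 div b. \<chi> a / sqrt (real a) * (1 / sqrt (real b))) \<le> 4 * real M"
proof -
  define B where "B = 2 * real M"
  have B0: "B \<ge> 0" by (simp add: B_def)
  have "(\<Sum>b=1..N. \<Sum>a=N+1..N\<^sup>2 div b. \<chi> a / sqrt (real a) * (1 / sqrt (real b)))
      \<le> (\<Sum>b=1..N. B / sqrt (real N) * (1 / sqrt (real b)))"
  proof (intro sum_mono)
    fix b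
    \<comment> \<open>Cancellation in chi gives order 1 / sqrt N uniformly in b, which balances the
      at most 2 sqrt N coming from the sum over b.\<close>
    have "\<bar>\<Sum>a=N+1..N\<^sup>2 div b. \<chi> a * (1 / sqrt (real a))\<bar> \<le> B * (1 / sqrt (real (N + 1)))"
      unfolding B_def by (intro abs_sum_mult_le) (auto simp: frac_le)
    also have "\<dots> \<le> B / sqrt (real N)"
      using N B0 by (simp add: frac_le)
    finally have "(\<Sum>a=N+1..N\<^sup>2 div b. \<chi> a * (1 / sqrt (real a))) * (1 / sqrt (real b)) \<le>
        B / sqrt (real N) * (1 / sqrt (real b))"
      by (intro mult_right_mono) auto
    then show "(\<Sum>a=N+1..N\<^sup>2 div b. \<chi> a / sqrt (real a) * (1 / sqrt (real b)))
        \<le> B / sqrt (real N) * (1 / sqrt (real b))"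
      by (simp only: sum_distrib_right [symmetric]) simp
  qed
  also have "\<dots> = B / sqrt (real N) * (\<Sum>b=1..N. 1 / sqrt (real b))"
    by (simp add: sum_distrib_left)
  also have "\<dots> \<le> B / sqrt (real N) * (2 * sqrt (real N))"
    using B0 by (intro mult_left_mono sum_inverse_sqrt_le) auto
  also have "\<dots> = 4 * real M" using N by (simp add: B_def)
  finally show ?thesis .
qed

text \<open>Here the sum over b is evaluated first. Its main term contributes 2 N times the sum of
  chi a / a, which stays bounded because the hypothesis \<open>L\<close> expresses that L(1, chi) is
  0. The term with c is bounded by Abel summation, and the N remainders are at most 4 / N
  each.\<close>

lemma hyperbola_head_le:
  assumes N: "N \<ge> 1"
    and L: "\<bar>\<Sum>n=1..N. \<chi> n * (1 / real n)\<bar> \<le> 2 * real M * (1 / real (Suc N))"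
    and c: "\<And>m a. 1 \<le> a \<Longrightarrow> a \<le> m \<Longrightarrow>
      \<bar>(\<Sum>b=1..m div a. 1 / sqrt (real b)) - 2 * sqrt (real m / real a) - c\<bar> \<le> 4 / sqrt (real m / real a)"
  shows "(\<Sum>a=1..N. \<Sum>b=1..N\<^sup>2 div a. \<chi> a / sqrt (real a) * (1 / sqrt (real b)))
           \<le> 4 * real M + \<bar>c\<bar> * (2 * real M) + 4"
proof -
  define B where "B = 2 * real M"
  have B0: "B \<ge> 0" by (simp add: B_def)
  define e where "e a = (\<Sum>b=1..N\<^sup>2 div a. 1 / sqrt (real b)) - 2 * sqrt (real (N\<^sup>2) / real a) - c" for a
  have eq1: "(\<Sum>b=1..N\<^sup>2 div a. \<chi> a / sqrt (real a) * (1 / sqrt (real b))) =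
      2 * real N * (\<chi> a * (1 / real a)) + c * (\<chi> a * (1 / sqrt (real a))) + \<chi> a / sqrt (real a) * e a" for a
  proof -
    have "(\<Sum>b=1..N\<^sup>2 div a. \<chi> a / sqrt (real a) * (1 / sqrt (real b))) =
        \<chi> a / sqrt (real a) * (2 * sqrt (real (N\<^sup>2) / real a) + c + e a)"
      unfolding sum_distrib_left [symmetric] e_def by simp
    moreover have "\<chi> a / sqrt (real a) * (2 * sqrt (real (N\<^sup>2) / real a)) = 2 * real N * (\<chi> a * (1 / real a))"
      by (simp add: real_sqrt_divide)
    ultimately show ?thesis
      by (simp add: distrib_left)
  qed
  have eq: "(\<Sum>a=1..N. \<Sum>b=1..N\<^sup>2 div a. \<chi> a / sqrt (real a) * (1 / sqrt (real b))) =
      2 * real N * (\<Sum>a=1..N. \<chi> a * (1 / real a)) + c * (\<Sum>a=1..N. \<chi> a * (1 / sqrt (real a)))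
        + (\<Sum>a=1..N. \<chi> a / sqrt (real a) * e a)"
    unfolding eq1 sum.distrib sum_distrib_left ..
  have "2 * real N * (\<Sum>a=1..N. \<chi> a * (1 / real a)) \<le> 2 * real N * (B * (1 / real (Suc N)))"
    using L by (intro mult_left_mono) (auto simp: B_def)
  also have "\<dots> \<le> 2 * B" using B0 by (simp add: field_simps)
  finally have b1: "2 * real N * (\<Sum>a=1..N. \<chi> a * (1 / real a)) \<le> 2 * B" .
  have "\<bar>\<Sum>a=1..N. \<chi> a * (1 / sqrt (real a))\<bar> \<le> B * (1 / sqrt (real 1))"
    unfolding B_def by (intro abs_sum_mult_le) (auto simp: frac_le)
  then have "\<bar>c\<bar> * \<bar>\<Sum>a=1..N. \<chi> a * (1 / sqrt (real a))\<bar> \<le> \<bar>c\<bar> * B"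
    by (intro mult_left_mono) auto
  then have b2: "c * (\<Sum>a=1..N. \<chi> a * (1 / sqrt (real a))) \<le> \<bar>c\<bar> * B"
    by (simp only: abs_mult [symmetric] abs_le_iff)
  have "(\<Sum>a=1..N. \<chi> a / sqrt (real a) * e a) \<le> (\<Sum>a=1..N. 4 / real N)"
  proof (intro sum_mono)
    fix a assume a: "a \<in> {1..N}"
    have "a \<le> N\<^sup>2" using a self_le_power [of N 2] by auto
    then have "\<bar>e a\<bar> \<le> 4 / sqrt (real (N\<^sup>2) / real a)"
      unfolding e_def using a by (intro c) auto
    then have e: "\<bar>e a\<bar> \<le> 4 * sqrt (real a) / real N"
      using N by (simp add: real_sqrt_divide)
    have "\<chi> a / sqrt (real a) * e a \<le> \<bar>\<chi> a / sqrt (real a) * e a\<bar>" by (rule abs_ge_self)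
    also have "\<dots> = \<bar>\<chi> a\<bar> / sqrt (real a) * \<bar>e a\<bar>" by (simp add: abs_mult)
    also have "\<dots> \<le> 1 / sqrt (real a) * (4 * sqrt (real a) / real N)"
      using abs_le_1 [of a] e by (intro mult_mono divide_right_mono) auto
    also have "\<dots> = 4 / real N" using a by simp
    finally show "\<chi> a / sqrt (real a) * e a \<le> 4 / real N" .
  qed
  also have "\<dots> = 4" using N by simp
  finally show ?thesis using b1 b2 unfolding eq by (simp add: B_def)
qed

text \<open>Let r(n) be the sum of chi over the divisors of n. The sum of r(n) / sqrt n over n <=
  N^2 is at least the harmonic sum up to N, by its square terms alone. If L were 0, both parts of
  the hyperbola, split at a = N, would stay bounded.\<close>

lemma L_one_nonzero:
  assumes L: "\<And>N. \<bar>(\<Sum>n=1..N. \<chi> n * (1 / real n)) - L\<bar> \<le> 2 * real M * (1 / real (Suc N))"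
  shows "L \<noteq> 0"
proof
  assume L0: "L = 0"
  obtain c where c: "\<And>m a. 1 \<le> a \<Longrightarrow> a \<le> m \<Longrightarrow>
      \<bar>(\<Sum>b=1..m div a. 1 / sqrt (real b)) - 2 * sqrt (real m / real a) - c\<bar> \<le> 4 / sqrt (real m / real a)"
    using sum_inverse_sqrt_div_asymp by blast
  define C where "C = 8 * real M + \<bar>c\<bar> * (2 * real M) + 4"
  have bound: "ln (real (Suc N)) \<le> C" if N: "N \<ge> 1" for N
  proof -
    define h where "h a b = \<chi> a / sqrt (real a) * (1 / sqrt (real b))" for a b
    have "ln (real (Suc N)) \<le> (\<Sum>m=1..N. 1 / real m)" by (rule ln_Suc_le_sum_inverse)
    also have "\<dots> \<le> (\<Sum>m=1..N. (\<Sum>d | d dvd m\<^sup>2. \<chi> d) / sqrt (real (m\<^sup>2)))"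
    proof (intro sum_mono)
      fix m assume "m \<in> {1..N}"
      then show "1 / real m \<le> (\<Sum>d | d dvd m\<^sup>2. \<chi> d) / sqrt (real (m\<^sup>2))"
        using sum_divisors_square_ge_1 [of m] by (simp add: divide_right_mono)
    qed
    also have "\<dots> = (\<Sum>n\<in>(\<lambda>m. m\<^sup>2) ` {1..N}. (\<Sum>d | d dvd n. \<chi> d) / sqrt (real n))"
      by (subst sum.reindex) (auto intro!: inj_onI)
    also have "\<dots> \<le> (\<Sum>n=1..N\<^sup>2. (\<Sum>d | d dvd n. \<chi> d) / sqrt (real n))"
      by (intro sum_mono2 divide_nonneg_nonneg sum_divisors_nonneg) (auto simp: power_mono)
    also have "\<dots> = (\<Sum>n=1..N\<^sup>2. \<Sum>d | d dvd n. h d (n div d))"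
    proof (intro sum.cong refl)
      fix n assume "n \<in> {1..N\<^sup>2}"
      have "(\<Sum>d | d dvd n. \<chi> d / sqrt (real n)) = (\<Sum>d | d dvd n. h d (n div d))"
        by (intro sum.cong refl) (auto simp: h_def real_sqrt_mult [symmetric] simp flip: of_nat_mult)
      then show "(\<Sum>d | d dvd n. \<chi> d) / sqrt (real n) = (\<Sum>d | d dvd n. h d (n div d))"
        by (simp add: sum_divide_distrib)
    qed
    also have "\<dots> = (\<Sum>a=1..N\<^sup>2. \<Sum>b=1..N\<^sup>2 div a. h a b)"
      by (rule sum_divisors_swap)
    also have "\<dots> = (\<Sum>a=1..N. \<Sum>b=1..N\<^sup>2 div a. h a b) + (\<Sum>a=N+1..N\<^sup>2. \<Sum>b=1..N\<^sup>2 div a. h a b)"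
      using N sum.ub_add_nat [of 1 N "\<lambda>a. \<Sum>b=1..N\<^sup>2 div a. h a b" "N\<^sup>2 - N"]
      by (simp add: power2_eq_square)
    \<comment> \<open>On a b <= N^2 the condition a > N forces b <= N. The exchange makes a the
      inner variable, where chi cancels.\<close>
    also have "(\<Sum>a=N+1..N\<^sup>2. \<Sum>b=1..N\<^sup>2 div a. h a b) = (\<Sum>b=1..N. \<Sum>a=N+1..N\<^sup>2 div b. h a b)"
    proof -
      have "b \<le> N" if "a * b \<le> N\<^sup>2" "a > N" for a b
      proof (rule ccontr)
        assume "\<not> b \<le> N"
        then have "N * N < a * b" using that N by (intro mult_strict_mono) auto
        then show False using that by (simp add: power2_eq_square)
      qed
      moreover have "b \<le> N\<^sup>2" if "a * b \<le> N\<^sup>2" "a > 0" for a b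
        using that by (metis One_nat_def Suc_leI dual_order.trans mult.left_neutral mult_le_mono1)
      ultimately have "(\<Sum>(a,b)\<in>(SIGMA a:{N+1..N\<^sup>2}. {1..N\<^sup>2 div a}). h a b) =
            (\<Sum>(b,a)\<in>(SIGMA b:{1..N}. {N+1..N\<^sup>2 div b}). h a b)"
        by (intro sum.reindex_bij_witness [of _ "\<lambda>(b,a). (a,b)" "\<lambda>(a,b). (b,a)"])
           (auto simp: less_eq_div_iff_mult_less_eq mult.commute Suc_le_eq)
      then show ?thesis by (simp add: sum.Sigma)
    qed
    finally show ?thesis
      using hyperbola_tail_le [OF N] hyperbola_head_le [OF N _ c] L [of N] L0
      unfolding h_def C_def by simp
  qed
  obtain N where N: "real N > exp C" using reals_Archimedean2 by blast
  then have N0: "real N > 0" by (rule less_trans [OF exp_gt_zero])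
  have "C < ln (real N)"
    using N ln_less_cancel_iff [OF exp_gt_zero N0] by (metis ln_exp)
  also have "ln (real N) \<le> ln (real (Suc N))" using N0 by simp
  finally show False using bound [of N] N0 by simp
qed

text \<open>Writing ln n as a divisor sum of \<open>mangoldt\<close> turns the sum of chi n ln n / n
  into a sum over d of chi d \<open>mangoldt\<close> d / d times a partial sum L + e d of the series
  for L. The former is bounded by Abel summation, and Chebyshev's bound absorbs the errors e d, of
  order d / N. So L times the wanted sum is bounded, and L is nonzero.\<close>

lemma sum_mangoldt_bounded:
  obtains C where "\<And>N. \<bar>\<Sum>n=1..N. \<chi> n * mangoldt n / real n\<bar> \<le> C"
proof -
  define B where "B = 2 * real M"
  have B0: "B \<ge> 0" by (simp add: B_def)
  have lim: "(\<lambda>n. 1 / real n) \<longlonglongrightarrow> 0" by (rule lim_1_over_n)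
  obtain L where L: "\<And>N. \<bar>(\<Sum>n=1..N. \<chi> n * (1 / real n)) - L\<bar> \<le> 2 * real M * (1 / real (Suc N))"
    using sum_mult_converges [of "\<lambda>n. 1 / real n"] lim by (auto simp: frac_le)
  have L0: "L \<noteq> 0" using L by (rule L_one_nonzero)
  \<comment> \<open>The function ln n / n decreases only from n = 3 on, as e < 3. The 2 covers n = 1
    and n = 2.\<close>
  define C where "C = 2 + B * (ln 3 / 3)"
  have ln_sum: "\<bar>\<Sum>n=1..N. \<chi> n * (ln (real n) / real n)\<bar> \<le> C" for N
  proof -
    have anti: "ln (real (Suc n)) / real (Suc n) \<le> ln (real n) / real n" if "n \<ge> 3" for n
    proof -
      have "ln (real (Suc n)) - ln (real n) \<le> 1 / real n"
        using ln_diff_le [of "real (Suc n)" "real n"] that by simp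
      moreover have "1 \<le> ln (real n)"
      proof -
        have "exp 1 \<le> real n" using exp_le that by (auto intro: order_trans [of _ 3])
        then show ?thesis using that by (subst ln_ge_iff) auto
      qed
      moreover have "real n * (ln (real (Suc n)) - ln (real n)) \<le> 1"
        using calculation(1) that by (simp add: field_simps)
      ultimately have "real n * ln (real (Suc n)) \<le> real (Suc n) * ln (real n)"
        by (simp add: algebra_simps)
      then show ?thesis using that by (simp add: field_simps)
    qed
    have tail: "\<bar>\<Sum>n=3..N. \<chi> n * (ln (real n) / real n)\<bar> \<le> B * (ln 3 / 3)"
      using abs_sum_mult_le [of 3 "\<lambda>n. ln (real n) / real n" N] anti by (simp add: B_def)
    show ?thesis
    proof (cases "N \<ge> 2")
      case True
      have "(\<Sum>n=1..N. \<chi> n * (ln (real n) / real n)) =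
          (\<Sum>n=1..2. \<chi> n * (ln (real n) / real n)) + (\<Sum>n=3..N. \<chi> n * (ln (real n) / real n))"
      proof -
        have "{1..N} = {1..2} \<union> {3..N}" using True by auto
        then show ?thesis by (simp add: sum.union_disjoint del: sum.atLeast_Suc_atMost)
      qed
      moreover have "\<bar>\<Sum>n=1..2. \<chi> n * (ln (real n) / real n)\<bar> \<le> 2"
      proof -
        have "\<bar>\<chi> 2 * (ln 2 / 2)\<bar> \<le> 1 * (ln 2 / 2)"
          unfolding abs_mult using abs_le_1 [of 2] by (intro mult_mono) auto
        then show ?thesis using ln_2_less_1 by (simp add: numeral_2_eq_2)
      qed
      ultimately show ?thesis using tail by (simp add: C_def)
    next
      case False
      then have "N = 0 \<or> N = 1" by auto
      then show ?thesis using B0 by (auto simp: C_def)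
    qed
  qed
  show ?thesis
  proof
    fix N
    define A where "A = (\<Sum>n=1..N. \<chi> n * mangoldt n / real n)"
    define e where "e d = (\<Sum>m=1..N div d. \<chi> m * (1 / real m)) - L" for d
    have "(\<Sum>n=1..N. \<chi> n * (ln (real n) / real n)) =
        (\<Sum>n=1..N. \<Sum>d | d dvd n. \<chi> d * mangoldt d / real d * (\<chi> (n div d) * (1 / real (n div d))))"
    proof (intro sum.cong refl)
      fix n assume n: "n \<in> {1..N}"
      have "\<chi> n * (ln (real n) / real n) = (\<Sum>d | d dvd n. \<chi> n / real n * mangoldt d)"
        using n mangoldt_sum [of n, where ?'a = real] by (simp only: sum_distrib_left [symmetric]) simp
      also have "\<dots> = (\<Sum>d | d dvd n. \<chi> d * mangoldt d / real d * (\<chi> (n div d) * (1 / real (n div d))))"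
      proof (intro sum.cong refl)
        fix d assume "d \<in> {d. d dvd n}"
        then obtain k where k: "n = d * k" by auto
        then show "\<chi> n / real n * mangoldt d = \<chi> d * mangoldt d / real d * (\<chi> (n div d) * (1 / real (n div d)))"
          using n by (simp add: mult)
      qed
      finally show "\<chi> n * (ln (real n) / real n) = \<dots>" .
    qed
    also have "\<dots> = (\<Sum>d=1..N. \<Sum>m=1..N div d. \<chi> d * mangoldt d / real d * (\<chi> m * (1 / real m)))"
      by (rule sum_divisors_swap)
    also have "\<dots> = (\<Sum>d=1..N. \<chi> d * mangoldt d / real d * (L + e d))"
      by (simp add: e_def sum_distrib_left)
    also have "\<dots> = L * A + (\<Sum>d=1..N. \<chi> d * mangoldt d / real d * e d)"
      by (simp add: A_def distrib_left add_divide_distrib sum.distrib sum_distrib_left mult_ac)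
    finally have eq: "L * A = (\<Sum>n=1..N. \<chi> n * (ln (real n) / real n)) -
        (\<Sum>d=1..N. \<chi> d * mangoldt d / real d * e d)" by simp
    have "\<bar>\<Sum>d=1..N. \<chi> d * mangoldt d / real d * e d\<bar> \<le> B * (2 * ln 4)"
    proof (cases "N = 0")
      case False
      have "\<bar>\<Sum>d=1..N. \<chi> d * mangoldt d / real d * e d\<bar> \<le> (\<Sum>d=1..N. B / real N * mangoldt d)"
      proof (intro sum_abs [THEN order_trans] sum_mono)
        fix d assume d: "d \<in> {1..N}"
        have "\<bar>e d\<bar> \<le> B * (1 / real (Suc (N div d)))" unfolding e_def B_def by (rule L)
        also have "\<dots> \<le> B * (real d / real N)"
        proof (intro mult_left_mono B0)
          have "N < d * Suc (N div d)"
            using d dividend_less_times_div [of d N] by simp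
          then have "real N \<le> real d * real (Suc (N div d))"
            by (metis of_nat_le_iff of_nat_mult less_imp_le)
          then show "1 / real (Suc (N div d)) \<le> real d / real N"
            using False by (simp add: field_simps)
        qed
        finally have e: "\<bar>e d\<bar> \<le> B * (real d / real N)" .
        have "\<bar>\<chi> d * mangoldt d / real d * e d\<bar> = \<bar>\<chi> d\<bar> * (mangoldt d / real d) * \<bar>e d\<bar>"
          by (simp add: abs_mult)
        also have "\<dots> \<le> 1 * (mangoldt d / real d) * (B * (real d / real N))"
          using abs_le_1 [of d] e mangoldt_nonneg [of d] by (intro mult_mono) auto
        also have "\<dots> = B / real N * mangoldt d" using d by simp
        finally show "\<bar>\<chi> d * mangoldt d / real d * e d\<bar> \<le> B / real N * mangoldt d" .
      qed
      also have "\<dots> = B / real N * (\<Sum>d=1..N. mangoldt d)" by (simp add: sum_distrib_left)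
      also have "\<dots> \<le> B / real N * (2 * ln 4 * real N)"
        using B0 by (intro mult_left_mono sum_mangoldt_le) auto
      also have "\<dots> = B * (2 * ln 4)" using False by simp
      finally show ?thesis .
    qed (use B0 in simp)
    with eq ln_sum [of N] have "\<bar>L * A\<bar> \<le> C + B * (2 * ln 4)" by linarith
    then show "\<bar>\<Sum>n=1..N. \<chi> n * mangoldt n / real n\<bar> \<le> (C + B * (2 * ln 4)) / \<bar>L\<bar>"
      using L0 unfolding A_def [symmetric] by (simp add: abs_mult field_simps)
  qed
qed

end

section \<open>Primes with prescribed character values\<close>

text \<open>Multiplication by a permutes the residues modulo M and multiplies the sum over a period
  by chi a = -1, so that sum is its own negative.\<close>

lemma real_character_if_value_neg:
  fixes \<chi> :: "nat \<Rightarrow> real"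
  assumes M: "M > 0" and per: "\<And>n. \<chi> (n + M) = \<chi> n"
    and mult: "\<And>a b. \<chi> (a * b) = \<chi> a * \<chi> b" and one: "\<chi> 1 = 1"
    and val: "\<And>n. \<chi> n \<in> {-1, 0, 1}" and a: "coprime a M" "\<chi> a = -1"
  shows "real_character \<chi> M"
proof
  have "\<chi> (n + M * k) = \<chi> n" for n k
    by (induction k) (auto simp: algebra_simps, metis per add.assoc add.commute)
  then have mod: "\<chi> (n mod M) = \<chi> n" for n by (metis mod_mult_div_eq)
  have inj: "inj_on (\<lambda>n. a * n mod M) {..<M}"
  proof (rule inj_onI)
    fix x y assume xy: "x \<in> {..<M}" "y \<in> {..<M}" "a * x mod M = a * y mod M"
    then have "[a * x = a * y] (mod M)" by (simp add: cong_def)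
    then have "[x = y] (mod M)" using a(1) cong_mult_lcancel_nat by blast
    then show "x = y" using xy by (simp add: cong_def)
  qed
  moreover have "(\<lambda>n. a * n mod M) ` {..<M} \<subseteq> {..<M}" using M by auto
  ultimately have "(\<lambda>n. a * n mod M) ` {..<M} = {..<M}"
    by (intro endo_inj_surj) auto
  then have "(\<Sum>n<M. \<chi> n) = (\<Sum>n<M. \<chi> (a * n mod M))"
    using sum.reindex [OF inj, of \<chi>] by simp
  also have "\<dots> = - (\<Sum>n<M. \<chi> n)"
    by (simp add: mod mult a sum_negf)
  finally show "(\<Sum>n<M. \<chi> n) = 0" by simp
qed (use assms in auto)

section \<open>Prime powers whose total contribution is bounded\<close>

lemma sum_inverse_powers_le:
  assumes "q \<ge> (2::nat)" shows "(\<Sum>k=1..N. 1 / real (q ^ k)) \<le> 1"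
proof -
  have "(\<Sum>k=1..N. 1 / real (q ^ k)) \<le> (\<Sum>k=1..N. 1 / 2 ^ k)"
    using assms by (intro sum_mono) (auto simp: frac_le power_mono)
  also have "\<dots> = 1 - 1 / 2 ^ N" by (induction N) (auto simp: field_simps)
  also have "\<dots> \<le> 1" by simp
  finally show ?thesis .
qed

text \<open>Each term from the second on is dominated by the telescoping difference 2 / sqrt (m - 1)
  - 2 / sqrt m, whence the stronger bound 3 - 2 / sqrt N for the induction.\<close>

lemma sum_inverse_mult_sqrt_le: "(\<Sum>m=1..N. 1 / (real m * sqrt (real m))) \<le> 3"
proof -
  have "(\<Sum>m=1..N. 1 / (real m * sqrt (real m))) \<le> 3 - 2 / sqrt (real N)" if "N \<ge> 1"
    using that
  proof (induction N rule: dec_induct)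
    case (step N)
    define x y where "x = sqrt (real N)" and "y = sqrt (real (Suc N))"
    have xy: "0 < x" "x < y" "y\<^sup>2 = x\<^sup>2 + 1" "real (Suc N) = y * y"
      using step.hyps by (simp_all add: x_def y_def)
    have "(y - x) * (y + x) = 1" using xy by (simp add: power2_eq_square algebra_simps)
    then have "1 \<le> (y - x) * (2 * y)"
      using xy mult_left_mono [of "y + x" "2 * y" "y - x"] by simp
    then have "x \<le> x * ((y - x) * (2 * y))" using xy by simp
    also have "\<dots> \<le> y * ((y - x) * (2 * y))" using xy by (intro mult_right_mono) auto
    finally have "x \<le> 2 * (y - x) * (y * y)" by (simp add: mult_ac)
    then have "1 / (y * y * y) \<le> 2 / x - 2 / y"
      using xy by (simp add: field_simps)
    with step.IH show ?case
      unfolding x_def [symmetric] y_def [symmetric] using xy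
      by (simp add: y_def [symmetric] x_def [symmetric] del: of_nat_Suc)
  qed auto
  then show ?thesis by (cases "N = 0") (auto intro: order_trans [of _ "3 - 2 / sqrt (real N)"])
qed

text \<open>The 4 comes from ln (m^2) = 4 ln (sqrt m) together with ln x <= x; the gain of sqrt m
  over m makes the sum over m converge.\<close>

lemma mangoldt_square_le:
  assumes "m \<ge> 1" shows "mangoldt (m\<^sup>2) / real (m\<^sup>2) \<le> 4 * (1 / (real m * sqrt (real m)))"
proof -
  have "mangoldt (m\<^sup>2) \<le> ln (real (m\<^sup>2))" using assms by (intro mangoldt_le) auto
  also have "\<dots> = 4 * ln (sqrt (real m))" using assms by (simp add: ln_realpow ln_sqrt)
  also have "\<dots> \<le> 4 * sqrt (real m)"
    using assms by (intro mult_left_mono less_imp_le ln_less_self) auto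
  finally have "mangoldt (m\<^sup>2) / real (m\<^sup>2) \<le> 4 * sqrt (real m) / real (m\<^sup>2)"
    by (rule divide_right_mono) auto
  also have "\<dots> = 4 * (1 / (real m * sqrt (real m)))"
    using assms by (simp add: field_simps power2_eq_square)
  finally show ?thesis .
qed

text \<open>This disposes of prime powers with even exponent, at which characters lose the sign they
  have at the prime.\<close>

lemma sum_mangoldt_squares_le:
  "(\<Sum>n\<in>{1..N} \<inter> range (\<lambda>m. m\<^sup>2). mangoldt n / real n) \<le> 12"
proof -
  have "{1..N} \<inter> range (\<lambda>m. m\<^sup>2) \<subseteq> (\<lambda>m. m\<^sup>2) ` {1..N}"
  proof
    fix n assume "n \<in> {1..N} \<inter> range (\<lambda>m. m\<^sup>2)"
    then obtain m where m: "n = m\<^sup>2" "1 \<le> n" "n \<le> N" by auto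
    then have "m \<ge> 1" by (cases m) auto
    moreover have "m \<le> N" using m self_le_power [OF \<open>m \<ge> 1\<close>, of 2] by auto
    ultimately show "n \<in> (\<lambda>m. m\<^sup>2) ` {1..N}" using m by auto
  qed
  then have "(\<Sum>n\<in>{1..N} \<inter> range (\<lambda>m. m\<^sup>2). mangoldt n / real n) \<le>
      (\<Sum>n\<in>(\<lambda>m. m\<^sup>2) ` {1..N}. mangoldt n / real n)"
    by (intro sum_mono2) (auto simp: mangoldt_nonneg)
  also have "\<dots> \<le> (\<Sum>m=1..N. mangoldt (m\<^sup>2) / real (m\<^sup>2))"
    by (subst sum.reindex) (auto intro!: inj_onI)
  also have "\<dots> \<le> (\<Sum>m=1..N. 4 * (1 / (real m * sqrt (real m))))"
    by (intro sum_mono mangoldt_square_le) auto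
  also have "\<dots> \<le> 4 * 3"
    unfolding sum_distrib_left [symmetric] by (intro mult_left_mono sum_inverse_mult_sqrt_le) auto
  finally show ?thesis by simp
qed

lemma sum_mangoldt_small_primes_le:
  "(\<Sum>n\<in>{1..N} \<inter> {q ^ k | q k. prime q \<and> q \<le> K \<and> k \<ge> 1}. mangoldt n / real n) \<le> (\<Sum>q | prime q \<and> q \<le> K. ln (real q))"
proof -
  define P where "P = {q. prime q \<and> q \<le> K}"
  have finP: "finite P" by (auto simp: P_def intro: finite_subset [of _ "{..K}"])
  have "{1..N} \<inter> {q ^ k | q k. prime q \<and> q \<le> K \<and> k \<ge> 1} \<subseteq> (\<lambda>(q, k). q ^ k) ` (P \<times> {1..N})"
  proof
    fix n assume "n \<in> {1..N} \<inter> {q ^ k | q k. prime q \<and> q \<le> K \<and> k \<ge> 1}"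
    then obtain q k where qk: "n = q ^ k" "prime q" "q \<le> K" "k \<ge> 1" "n \<le> N" by auto
    have "k < q ^ k" using prime_gt_1_nat [OF qk(2)] by (simp add: power_gt_expt)
    then show "n \<in> (\<lambda>(q, k). q ^ k) ` (P \<times> {1..N})"
      using qk by (intro image_eqI [of _ _ "(q, k)"]) (auto simp: P_def)
  qed
  then have "(\<Sum>n\<in>{1..N} \<inter> {q ^ k | q k. prime q \<and> q \<le> K \<and> k \<ge> 1}. mangoldt n / real n) \<le>
      (\<Sum>n\<in>(\<lambda>(q, k). q ^ k) ` (P \<times> {1..N}). mangoldt n / real n)"
    using finP by (intro sum_mono2) (auto simp: mangoldt_nonneg)
  also have "\<dots> \<le> (\<Sum>x\<in>P \<times> {1..N}. ((\<lambda>n. mangoldt n / real n) \<circ> (\<lambda>(q, k). q ^ k)) x)"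
    using finP by (intro sum_image_le) (auto simp: mangoldt_nonneg)
  also have "\<dots> = (\<Sum>q\<in>P. \<Sum>k=1..N. ln (real q) * (1 / real (q ^ k)))"
    by (subst sum.cartesian_product) (auto intro!: sum.cong simp: P_def)
  also have "\<dots> \<le> (\<Sum>q\<in>P. ln (real q))"
  proof (intro sum_mono)
    fix q assume "q \<in> P"
    then have q: "q \<ge> 2" by (auto simp: P_def prime_ge_2_nat)
    have "(\<Sum>k=1..N. ln (real q) * (1 / real (q ^ k))) \<le> ln (real q) * 1"
      unfolding sum_distrib_left [symmetric] using q by (intro mult_left_mono sum_inverse_powers_le) auto
    then show "(\<Sum>k=1..N. ln (real q) * (1 / real (q ^ k))) \<le> ln (real q)" by simp
  qed
  finally show ?thesis by (simp add: P_def)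
qed

text \<open>Dirichlet's argument. The weight \<open>g\<close> vanishes at n as soon as one f i n is
  the opposite of its prescribed sign. Summed against mangoldt n / n it diverges, since
  \<open>indep\<close> gives every product over a nonempty subset of I the value -1 at some a
  coprime to M, so that only the empty subset contributes an unbounded sum. Without a suitable q > K
  the weight would live on squares and on powers of primes up to K. The value 0 is tolerated because
  its factor is 1; the application rules it out.\<close>

theorem prime_with_prescribed_character_values:
  fixes f :: "'i \<Rightarrow> nat \<Rightarrow> real"
  assumes I: "finite I" and M: "M > 0"
    and per: "\<And>i n. i \<in> I \<Longrightarrow> f i (n + M) = f i n"
    and mult: "\<And>i a b. i \<in> I \<Longrightarrow> f i (a * b) = f i a * f i b"
    and one: "\<And>i. i \<in> I \<Longrightarrow> f i 1 = 1"
    and val: "\<And>i n. i \<in> I \<Longrightarrow> f i n \<in> {-1, 0, 1}"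
    and indep: "\<And>i. i \<in> I \<Longrightarrow> \<exists>a. coprime a M \<and> f i a = -1 \<and> (\<forall>j\<in>I-{i}. f j a = 1)"
    and eps: "\<And>i. i \<in> I \<Longrightarrow> \<epsilon> i \<in> {-1, 1 :: real}"
  shows "\<exists>q>K. prime q \<and> (\<forall>i\<in>I. f i q \<in> {0, \<epsilon> i})"
proof (rule ccontr)
  assume neg: "\<not> ?thesis"
  define \<chi> where "\<chi> T n = (\<Prod>i\<in>T. f i n)" for T n
  define g where "g n = (\<Prod>i\<in>I. \<epsilon> i * f i n + 1)" for n
  have fe: "\<epsilon> i * f i n + 1 \<in> {0, 1, 2}" if "i \<in> I" for i n
    using val [OF that, of n] eps [OF that] by auto
  have char: "real_character (\<chi> T) M" if T: "T \<subseteq> I" "T \<noteq> {}" for T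
  proof -
    obtain i where i: "i \<in> T" using T by auto
    with T have "i \<in> I" by auto
    from indep [OF this] obtain a where a: "coprime a M" "f i a = -1" "\<forall>j\<in>I-{i}. f j a = 1"
      by blast
    have "finite T" using T I finite_subset by blast
    have "(\<Prod>j\<in>T-{i}. f j a) = 1" using T a(3) by (intro prod.neutral) blast
    then have "\<chi> T a = -1"
      unfolding \<chi>_def using prod.remove [OF \<open>finite T\<close> i, of "\<lambda>j. f j a"] a(2) by simp
    moreover have "\<chi> T n \<in> {-1, 0, 1}" for n
      unfolding \<chi>_def using \<open>finite T\<close> T(1)
    proof (induction T rule: finite_induct)
      case (insert i T)
      then show ?case using val [of i n] by auto
    qed auto
    moreover have "\<chi> T (n + M) = \<chi> T n" for n
      unfolding \<chi>_def using T per by (intro prod.cong) auto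
    moreover have "\<chi> T (x * y) = \<chi> T x * \<chi> T y" for x y
      unfolding \<chi>_def prod.distrib [symmetric] using T mult by (intro prod.cong) auto
    moreover have "\<chi> T 1 = 1"
      unfolding \<chi>_def using T one by (intro prod.neutral) auto
    ultimately show ?thesis using M a(1) by (intro real_character_if_value_neg) auto
  qed
  have "\<forall>T\<in>Pow I - {{}}. \<exists>C. \<forall>N. \<bar>\<Sum>n=1..N. \<chi> T n * mangoldt n / real n\<bar> \<le> C"
  proof
    fix T assume "T \<in> Pow I - {{}}"
    then interpret real_character "\<chi> T" M by (intro char) auto
    show "\<exists>C. \<forall>N. \<bar>\<Sum>n=1..N. \<chi> T n * mangoldt n / real n\<bar> \<le> C"
      using sum_mangoldt_bounded by metis
  qed
  then obtain C where C: "\<And>T N. T \<in> Pow I - {{}} \<Longrightarrow> \<bar>\<Sum>n=1..N. \<chi> T n * mangoldt n / real n\<bar> \<le> C T"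
    by metis
  define C1 where "C1 = (\<Sum>T\<in>Pow I - {{}}. C T)"
  have lower: "ln (real N) - 1 - C1 \<le> (\<Sum>n=1..N. g n * (mangoldt n / real n))" if N: "N \<ge> 1" for N
  proof -
    \<comment> \<open>Expanding the product over I gives one character sum for each subset T; T = {}
      gives the sum without character.\<close>
    have "(\<Sum>n=1..N. g n * (mangoldt n / real n)) =
        (\<Sum>n=1..N. \<Sum>T\<in>Pow I. (\<Prod>i\<in>T. \<epsilon> i) * (\<chi> T n * mangoldt n / real n))"
      unfolding g_def prod_add [OF I] sum_distrib_right
      by (intro sum.cong refl) (simp add: \<chi>_def prod.distrib)
    also have "\<dots> = (\<Sum>T\<in>Pow I. (\<Prod>i\<in>T. \<epsilon> i) * (\<Sum>n=1..N. \<chi> T n * mangoldt n / real n))"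
      by (subst sum.swap) (simp add: sum_distrib_left)
    also have "\<dots> = (\<Sum>n=1..N. mangoldt n / real n) +
        (\<Sum>T\<in>Pow I - {{}}. (\<Prod>i\<in>T. \<epsilon> i) * (\<Sum>n=1..N. \<chi> T n * mangoldt n / real n))"
      using I by (subst sum.remove [of _ "{}"]) (auto simp: \<chi>_def)
    finally have eq: "(\<Sum>n=1..N. g n * (mangoldt n / real n)) = \<dots>" .
    have "\<bar>\<Sum>T\<in>Pow I - {{}}. (\<Prod>i\<in>T. \<epsilon> i) * (\<Sum>n=1..N. \<chi> T n * mangoldt n / real n)\<bar> \<le> C1"
      unfolding C1_def
    proof (intro sum_abs [THEN order_trans] sum_mono)
      fix T assume T: "T \<in> Pow I - {{}}"
      have "\<bar>\<Prod>i\<in>T. \<epsilon> i\<bar> = (\<Prod>i\<in>T. \<bar>\<epsilon> i\<bar>)" by (rule abs_prod)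
      also have "\<dots> = 1" using T eps by (intro prod.neutral) fastforce
      finally show "\<bar>(\<Prod>i\<in>T. \<epsilon> i) * (\<Sum>n=1..N. \<chi> T n * mangoldt n / real n)\<bar> \<le> C T"
        using C [OF T, of N] by (simp add: abs_mult)
    qed
    with eq sum_mangoldt_div_ge [OF N] show ?thesis by linarith
  qed
  define C2 where "C2 = 2 ^ card I * (12 + (\<Sum>q | prime q \<and> q \<le> K. ln (real q)))"
  have upper: "(\<Sum>n=1..N. g n * (mangoldt n / real n)) \<le> C2" for N
  proof -
    define S where "S = range (\<lambda>m::nat. m\<^sup>2)"
    define Q where "Q = {q ^ k | q k. prime q \<and> q \<le> K \<and> k \<ge> (1::nat)}"
    define \<mu> where "\<mu> n = (mangoldt n / real n :: real)" for n
    have mu0: "\<mu> n \<ge> 0" for n by (simp add: \<mu>_def mangoldt_nonneg)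
    have "g n * \<mu> n \<le> 2 ^ card I * ((if n \<in> S then \<mu> n else 0) + (if n \<in> Q then \<mu> n else 0))" for n
    proof (cases "g n * \<mu> n = 0")
      case True
      have "0 \<le> 2 ^ card I * ((if n \<in> S then \<mu> n else 0) + (if n \<in> Q then \<mu> n else 0))"
        using mu0 by simp
      with True show ?thesis by (simp only:)
    next
      case False
      then have "mangoldt n \<noteq> (0::real)" by (auto simp: \<mu>_def)
      then obtain q k where qk: "prime q" "k > 0" "n = q ^ k"
        by (auto simp: mangoldt_def primepow_def split: if_splits)
      have "n \<in> S \<or> n \<in> Q"
      proof (cases "even k")
        case True
        then have "n = (q ^ (k div 2))\<^sup>2" using qk by (simp flip: power_mult)
        then show ?thesis by (auto simp: S_def)
      next
        case odd: False
        \<comment> \<open>Odd powers of -1, 0 and 1 equal their base, so a wrong sign at q persists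
          at n = q ^ k.\<close>
        have fq: "f i n = f i q" if i: "i \<in> I" for i
        proof -
          have "f i (q ^ j) = f i q ^ j" for j
            by (induction j) (use mult [OF i] one [OF i] in auto)
          then show ?thesis using val [OF i, of q] odd qk by auto
        qed
        have "q \<le> K"
        proof (rule ccontr)
          assume "\<not> q \<le> K"
          then obtain i where i: "i \<in> I" "f i q \<notin> {0, \<epsilon> i}" using neg qk(1) by (auto simp: not_le)
          then have "\<epsilon> i * f i n + 1 = 0"
            using val [OF i(1), of q] eps [OF i(1)] fq [OF i(1)] by auto
          then have "g n = 0" unfolding g_def using I i by (intro prod_zero) auto
          then show False using False by simp
        qed
        then show ?thesis using qk by (auto simp: Q_def Suc_le_eq)
      qed
      then have "\<mu> n \<le> (if n \<in> S then \<mu> n else 0) + (if n \<in> Q then \<mu> n else 0)"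
        using mu0 [of n] by auto
      moreover have "0 \<le> g n" "g n \<le> 2 ^ card I"
      proof -
        have fe': "0 \<le> \<epsilon> i * f i n + 1 \<and> \<epsilon> i * f i n + 1 \<le> 2" if "i \<in> I" for i
          using fe [OF that, of n] by auto
        show "0 \<le> g n" unfolding g_def using fe' by (intro prod_nonneg) auto
        have "g n \<le> (\<Prod>i\<in>I. 2)" unfolding g_def by (intro prod_mono fe')
        then show "g n \<le> 2 ^ card I" by simp
      qed
      ultimately show ?thesis using mu0 [of n] by (intro mult_mono) auto
    qed
    then have "(\<Sum>n=1..N. g n * \<mu> n) \<le>
        (\<Sum>n=1..N. 2 ^ card I * ((if n \<in> S then \<mu> n else 0) + (if n \<in> Q then \<mu> n else 0)))"
      by (intro sum_mono)
    also have "\<dots> = 2 ^ card I * ((\<Sum>n\<in>{1..N} \<inter> S. \<mu> n) + (\<Sum>n\<in>{1..N} \<inter> Q. \<mu> n))"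
      unfolding sum_distrib_left [symmetric] sum.distrib by (simp add: sum.inter_restrict)
    also have "\<dots> \<le> C2"
      unfolding C2_def S_def Q_def \<mu>_def
      by (intro mult_left_mono add_mono sum_mangoldt_squares_le sum_mangoldt_small_primes_le) auto
    finally show ?thesis by (simp add: \<mu>_def)
  qed
  obtain N where N: "real N > exp (C2 + C1 + 1)" using reals_Archimedean2 by blast
  then have N0: "real N > 0" by (rule less_trans [OF exp_gt_zero])
  have "C2 + C1 + 1 < ln (real N)"
    using N ln_less_cancel_iff [OF exp_gt_zero N0] by (metis ln_exp)
  with lower [of N] upper [of N] N0 show False by simp
qed

section \<open>Quadratic characters\<close>

lemma Legendre_cases: "Legendre a p \<in> {-1, 0, 1}"
  by (auto simp: Legendre_def)

lemma Legendre_cong: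
  assumes "[a = b] (mod p)" shows "Legendre a p = Legendre b p"
proof -
  have "[a = 0] (mod p) \<longleftrightarrow> [b = 0] (mod p)" "QuadRes p a \<longleftrightarrow> QuadRes p b"
    using assms unfolding QuadRes_def by (meson cong_sym cong_trans)+
  then show ?thesis by (simp add: Legendre_def)
qed

text \<open>Two such values differ by at most 2 < p. This turns the congruences of Euler's criterion
  into equations.\<close>

lemma Legendre_eq_if_cong:
  assumes "x \<in> {-1, 0, 1}" "y \<in> {-1, 0, 1 :: int}" "[x = y] (mod int p)" "p > 2"
  shows "x = y"
proof -
  have "int p dvd x - y" using assms(3) by (simp add: cong_iff_dvd_diff)
  moreover have "\<bar>x - y\<bar> < int p" using assms by auto
  ultimately show ?thesis using dvd_imp_le_int [of "x - y" "int p"] by auto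
qed

lemma Legendre_mult:
  assumes "prime p" "p > 2"
  shows "Legendre (a * b) (int p) = Legendre a (int p) * Legendre b (int p)"
proof (rule Legendre_eq_if_cong)
  show "Legendre a (int p) * Legendre b (int p) \<in> {-1, 0, 1}"
    using Legendre_cases [of a "int p"] Legendre_cases [of b "int p"] by auto
  have "[Legendre (a * b) (int p) = (a * b) ^ ((p - 1) div 2)] (mod int p)"
    using assms by (rule euler_criterion)
  moreover have "[Legendre a (int p) * Legendre b (int p) = a ^ ((p - 1) div 2) * b ^ ((p - 1) div 2)] (mod int p)"
    using assms by (intro cong_mult euler_criterion)
  ultimately show "[Legendre (a * b) (int p) = Legendre a (int p) * Legendre b (int p)] (mod int p)"
    by (simp add: power_mult_distrib) (metis cong_sym cong_trans)
qed (use assms Legendre_cases in auto)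

lemma Legendre_one: "p > 1 \<Longrightarrow> Legendre 1 p = 1"
  by (auto simp: Legendre_def QuadRes_def cong_def intro!: exI [of _ 1])

text \<open>Because z and p - z have the same square, the nonzero squares modulo p = 2 h + 1 already
  occur among 1, ..., h. They cannot fill all 2 h nonzero classes.\<close>

lemma nonresidue_exists:
  assumes "prime p" "p > (2::nat)"
  obtains a where "a < p" "Legendre (int a) (int p) = -1"
proof -
  have "\<exists>a\<in>{0<..<p}. \<not> QuadRes (int p) (int a)"
  proof (rule ccontr)
    assume "\<not> ?thesis"
    then have all: "QuadRes (int p) (int a)" if "0 < a" "a < p" for a using that by auto
    define h where "h = (p - 1) div 2"
    have odd: "p = 2 * h + 1" using prime_odd_nat [OF assms(1)] assms(2) by (auto simp: h_def elim: oddE)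
    have "{1..<p} \<subseteq> (\<lambda>y. y\<^sup>2 mod p) ` {1..h}"
    proof
      fix a assume a: "a \<in> {1..<p}"
      then obtain y where y: "[y\<^sup>2 = int a] (mod int p)" using all [of a] by (auto simp: QuadRes_def)
      define z where "z = nat (y mod int p)"
      have zy: "int z = y mod int p" using assms by (simp add: z_def)
      have "[int (z\<^sup>2) = int a] (mod int p)"
        using y unfolding of_nat_power zy by (simp add: cong_def power_mod)
      then have zc: "[z\<^sup>2 = a] (mod p)" by (simp only: cong_int_iff)
      have zp: "z < p" using assms unfolding z_def by (simp add: nat_less_iff)
      have z0: "z > 0" using zc a by (auto intro!: Nat.gr0I simp: cong_def)
      show "a \<in> (\<lambda>y. y\<^sup>2 mod p) ` {1..h}"
      proof (cases "z \<le> h")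
        case True
        then show ?thesis using zc z0 a by (intro image_eqI [of _ _ z]) (auto simp: cong_def)
      next
        case False
        have "[int (p - z) = - int z] (mod int p)"
          using zp by (simp add: cong_iff_dvd_diff of_nat_diff)
        then have "[int (p - z) ^ 2 = (- int z) ^ 2] (mod int p)" by (rule cong_pow)
        then have "[int ((p - z)\<^sup>2) = int (z\<^sup>2)] (mod int p)" by simp
        then have "[(p - z)\<^sup>2 = z\<^sup>2] (mod p)" by (simp only: cong_int_iff)
        then have "[(p - z)\<^sup>2 = a] (mod p)" using zc cong_trans by blast
        moreover have "p - z \<in> {1..h}" using False odd zp by auto
        ultimately show ?thesis using a by (intro image_eqI [of _ _ "p - z"]) (auto simp: cong_def)
      qed
    qed
    then have "card {1..<p} \<le> card {1..h}"
      by (meson card_image_le card_mono finite_atLeastAtMost finite_imageI order_trans)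
    then show False using odd assms(2) by simp
  qed
  then obtain a where "0 < a" "a < p" "\<not> QuadRes (int p) (int a)" by auto
  then show ?thesis by (intro that [of a]) (auto simp: Legendre_def cong_def)
qed

text \<open>At odd primes p, \<open>chi4\<close> and \<open>chi8\<close> are the symbols (-1/p) and
  (2/p). As functions of n they are completely multiplicative, so reciprocity products can be
  evaluated from N modulo 8 alone.\<close>

definition chi4 :: "nat \<Rightarrow> int" where
  "chi4 n = (if n mod 4 = 1 then 1 else if n mod 4 = 3 then -1 else 0)"

definition chi8 :: "nat \<Rightarrow> int" where
  "chi8 n = (if n mod 8 \<in> {1, 7} then 1 else if n mod 8 \<in> {3, 5} then -1 else 0)"

lemma chi4_mult: "chi4 (a * b) = chi4 a * chi4 b"
proof -
  have eq: "a * b mod 4 = (a mod 4) * (b mod 4) mod 4" by (rule mod_mult_eq [symmetric])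
  have "a mod 4 = 0 \<or> a mod 4 = 1 \<or> a mod 4 = 2 \<or> a mod 4 = 3"
    "b mod 4 = 0 \<or> b mod 4 = 1 \<or> b mod 4 = 2 \<or> b mod 4 = 3"
    by presburger+
  then show ?thesis
    unfolding chi4_def eq by (elim disjE) simp_all
qed

lemma chi8_mult: "chi8 (a * b) = chi8 a * chi8 b"
proof -
  have eq: "a * b mod 8 = (a mod 8) * (b mod 8) mod 8" by (rule mod_mult_eq [symmetric])
  have "a mod 8 = 0 \<or> a mod 8 = 1 \<or> a mod 8 = 2 \<or> a mod 8 = 3 \<or> a mod 8 = 4 \<or> a mod 8 = 5 \<or> a mod 8 = 6 \<or> a mod 8 = 7"
    "b mod 8 = 0 \<or> b mod 8 = 1 \<or> b mod 8 = 2 \<or> b mod 8 = 3 \<or> b mod 8 = 4 \<or> b mod 8 = 5 \<or> b mod 8 = 6 \<or> b mod 8 = 7"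
    by presburger+
  then show ?thesis
    unfolding chi8_def eq by (elim disjE) simp_all
qed

text \<open>The indices 4 and 8, which are not prime, stand for the two generating characters modulo 8.\<close>
definition quadratic_character :: "nat \<Rightarrow> nat \<Rightarrow> int" where
  "quadratic_character i n =
     (if i = 4 then chi4 n else if i = 8 then chi8 n else Legendre (int n) (int i))"

lemma quadratic_character_mult:
  assumes "i = 4 \<or> i = 8 \<or> prime i \<and> i > 2"
  shows "quadratic_character i (a * b) = quadratic_character i a * quadratic_character i b"
  using assms by (auto simp: quadratic_character_def chi4_mult chi8_mult Legendre_mult)

lemma quadratic_character_one:
  assumes "i > 1" shows "quadratic_character i 1 = 1"
  using assms by (simp add: quadratic_character_def chi4_def chi8_def Legendre_one)

lemma quadratic_character_cases: "quadratic_character i n \<in> {-1, 0, 1}"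
  using Legendre_cases by (auto simp: quadratic_character_def chi4_def chi8_def)

lemma quadratic_character_cong:
  assumes "[m = n] (mod i)" "[m = n] (mod 8)"
  shows "quadratic_character i m = quadratic_character i n"
proof -
  have "[m = n] (mod 4)" using assms(2) by (rule cong_dvd_modulus_nat) auto
  then have "chi4 m = chi4 n" by (simp add: chi4_def cong_def)
  moreover have "chi8 m = chi8 n" using assms(2) by (simp add: chi8_def cong_def)
  moreover have "Legendre (int m) (int i) = Legendre (int n) (int i)"
    using assms(1) by (intro Legendre_cong) (simp only: cong_int_iff)
  ultimately show ?thesis by (simp add: quadratic_character_def)
qed

text \<open>Index 4 with sign 1 forces q = 1 (mod 4), and the sign at index 8 then decides between 1
  and 5 modulo 8. Independence of the characters comes from the Chinese remainder theorem.\<close>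

theorem prime_with_prescribed_Legendre:
  assumes P: "finite P" "\<And>p. p \<in> P \<Longrightarrow> prime p \<and> p > 2"
    and \<delta>: "\<And>p. p \<in> P \<Longrightarrow> \<delta> p \<in> {-1, 1 :: int}" and s: "s \<in> {1, 5 :: nat}"
  obtains q where "prime q" "q > K" "q mod 8 = s" "\<And>p. p \<in> P \<Longrightarrow> Legendre (int q) (int p) = \<delta> p"
proof -
  define I where "I = insert 4 (insert 8 P)"
  define M where "M = 8 * (\<Prod>p\<in>P. p)"
  define \<epsilon> where "\<epsilon> i = (if i = 4 then 1 else if i = 8 then (if s = 1 then 1 else -1) else \<delta> i)" for i
  have notprime: "\<not> prime (4::nat)" "\<not> prime (8::nat)"
    using prime_odd_nat [of 4] prime_odd_nat [of 8] by auto
  have P48: "4 \<notin> P" "8 \<notin> P" using P(2) notprime by blast+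
  have I: "i = 4 \<or> i = 8 \<or> prime i \<and> i > 2" if "i \<in> I" for i
    using that P(2) by (auto simp: I_def)
  have cop: "coprime (8::nat) p" if "p \<in> P" for p
  proof -
    have "coprime 2 p" using P(2) [OF that] by (metis primes_coprime two_is_prime_nat less_irrefl)
    then have "coprime (2 ^ 3) p" by (rule coprime_power_left_iff [THEN iffD2, OF disjI1])
    then show ?thesis by simp
  qed
  have prod_pos: "(\<Prod>p\<in>P. p) > 0" using P by (intro prod_pos) (auto dest: prime_gt_0_nat)
  have cong_prod: "[a = b] (mod p)" if "[a = b] (mod (\<Prod>p\<in>Q. p))" "p \<in> Q" "Q \<subseteq> P" for a b p and Q
  proof -
    have "p dvd (\<Prod>p\<in>Q. p)" using that P(1) by (intro dvd_prodI) (auto dest: finite_subset)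
    with that(1) show ?thesis by (rule cong_dvd_modulus_nat)
  qed
  have cop1: "coprime a (\<Prod>p\<in>Q. p)" if "[a = 1] (mod (\<Prod>p\<in>Q. p))" for a :: nat and Q
    using cong_imp_coprime [OF cong_sym [OF that]] by simp
  have cop8: "coprime (8::nat) (\<Prod>p\<in>Q. p)" if "Q \<subseteq> P" for Q
    using cop that by (intro prod_coprime_right) auto
  \<comment> \<open>From q > M >= p follows that no p in P divides q, and M >= 8 makes q odd; this
    excludes the value 0 below.\<close>
  have "\<exists>q>K + M. prime q \<and> (\<forall>i\<in>I. real_of_int (quadratic_character i q) \<in> {0, real_of_int (\<epsilon> i)})"
  proof (rule prime_with_prescribed_character_values)
    show "finite I" using P by (simp add: I_def)
    show "M > 0" using prod_pos by (simp add: M_def)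
  next
    fix i n assume i: "i \<in> I"
    have "[n + M = n] (mod 8)" by (simp add: cong_def M_def)
    moreover have "[n + M = n] (mod i)" if "i \<in> P"
    proof -
      have "i dvd (\<Prod>p\<in>P. p)" using that P(1) by (intro dvd_prodI) auto
      then have "i dvd M" by (simp add: M_def)
      then show ?thesis by (auto simp: cong_def elim!: dvdE)
    qed
    moreover have "[n + M = n] (mod i)" if "i \<in> {4, 8}"
      using that cong_dvd_modulus_nat [OF \<open>[n + M = n] (mod 8)\<close>, of 4] calculation(1) by auto
    ultimately have "quadratic_character i (n + M) = quadratic_character i n"
      using i by (intro quadratic_character_cong) (auto simp: I_def)
    then show "real_of_int (quadratic_character i (n + M)) = real_of_int (quadratic_character i n)" by simp
  next
    fix i a b assume "i \<in> I"
    then show "real_of_int (quadratic_character i (a * b)) =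
        real_of_int (quadratic_character i a) * real_of_int (quadratic_character i b)"
      using quadratic_character_mult [OF I] by simp
  next
    fix i assume "i \<in> I"
    then have "i > 1" using I by force
    then show "real_of_int (quadratic_character i 1) = 1" using quadratic_character_one by simp
  next
    fix i n assume "i \<in> I"
    show "real_of_int (quadratic_character i n) \<in> {-1, 0, 1}"
      using quadratic_character_cases [of i n] by auto
  next
    fix i assume "i \<in> I"
    then show "real_of_int (\<epsilon> i) \<in> {-1, 1}"
      using \<delta> [of i] by (auto simp: \<epsilon>_def I_def)
  next
    fix i assume i: "i \<in> I"
    have char1: "quadratic_character p a = 1" if "p \<in> P" "[a = 1] (mod p)" for p a
    proof -
      have "[int a = 1] (mod int p)" using that(2) by (metis cong_int_iff of_nat_1)
      then have "Legendre (int a) (int p) = Legendre 1 (int p)" by (rule Legendre_cong)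
      then show ?thesis using that(1) P48 P(2) [OF that(1)] Legendre_one [of "int p"]
        by (auto simp: quadratic_character_def)
    qed
    \<comment> \<open>Trivial at all of P with a free odd class u modulo 8: u = 7 flips only
      \<open>chi4\<close>, u = 5 flips only \<open>chi8\<close>.\<close>
    have two: "\<exists>a. coprime a M \<and> [a = u] (mod 8) \<and> (\<forall>p\<in>P. quadratic_character p a = 1)" if "odd u" for u
    proof -
      have "coprime u 2" using that by simp
      then have "coprime u (2 ^ 3)" by (rule coprime_power_right_iff [THEN iffD2, OF disjI1])
      then have "coprime u 8" by simp
      obtain a where a: "[a = u] (mod 8)" "[a = 1] (mod (\<Prod>p\<in>P. p))"
        using binary_chinese_remainder_nat [OF cop8 [OF subset_refl], of u 1] by blast
      have "coprime a 8" using cong_imp_coprime [OF cong_sym [OF a(1)] \<open>coprime u 8\<close>] .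
      then have "coprime a M" using cop1 [OF a(2)] by (simp add: M_def)
      moreover have "\<forall>p\<in>P. quadratic_character p a = 1"
        using char1 cong_prod [OF a(2) _ subset_refl] by blast
      ultimately show ?thesis using a(1) by blast
    qed
    have "\<exists>a. coprime a M \<and> quadratic_character i a = -1 \<and> (\<forall>j\<in>I-{i}. quadratic_character j a = 1)"
    proof -
      consider "i = 4" | "i = 8" | "i \<in> P" using i by (auto simp: I_def)
      then show ?thesis
      proof cases
        case 1
        have "odd (7::nat)" by simp
        from two [OF this] obtain a where a: "coprime a M" "[a = 7] (mod 8)" "\<forall>p\<in>P. quadratic_character p a = 1"
          by blast
        have "a mod 8 = 7" using a(2) by (simp add: cong_def)
        moreover from this have "a mod 4 = 3" using mod_mod_cancel [of 4 8 a] by simp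
        ultimately have "quadratic_character 4 a = -1" "quadratic_character 8 a = 1"
          by (simp_all add: quadratic_character_def chi4_def chi8_def)
        then show ?thesis using a(1,3) unfolding 1 I_def by (intro exI [of _ a]) auto
      next
        case 2
        have "odd (5::nat)" by simp
        from two [OF this] obtain a where a: "coprime a M" "[a = 5] (mod 8)" "\<forall>p\<in>P. quadratic_character p a = 1"
          by blast
        have "a mod 8 = 5" using a(2) by (simp add: cong_def)
        moreover from this have "a mod 4 = 1" using mod_mod_cancel [of 4 8 a] by simp
        ultimately have "quadratic_character 4 a = 1" "quadratic_character 8 a = -1"
          by (simp_all add: quadratic_character_def chi4_def chi8_def)
        then show ?thesis using a(1,3) unfolding 2 I_def by (intro exI [of _ a]) auto
      next
        case 3
        \<comment> \<open>To flip the symbol at i alone, take a nonresidue modulo i that is 1 modulo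
          8 and modulo the other primes.\<close>
        define R where "R = 8 * (\<Prod>p\<in>P-{i}. p)"
        obtain b where b: "b < i" "Legendre (int b) (int i) = -1"
          by (rule nonresidue_exists [of i]) (use P(2) [OF 3] in auto)
        have "coprime i p" if "p \<in> P - {i}" for p
          using that P(2) 3 by (intro primes_coprime) auto
        then have "coprime i (\<Prod>p\<in>P-{i}. p)" by (intro prod_coprime_right) auto
        then have "coprime i R" using coprime_commute [THEN iffD1, OF cop [OF 3]] by (simp add: R_def)
        then obtain a where a: "[a = b] (mod i)" "[a = 1] (mod R)"
          using binary_chinese_remainder_nat by blast
        have a8: "[a = 1] (mod 8)" using a(2) by (rule cong_dvd_modulus_nat) (simp add: R_def)
        have aR: "[a = 1] (mod (\<Prod>p\<in>P-{i}. p))" using a(2) by (rule cong_dvd_modulus_nat) (simp add: R_def)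
        have "Legendre (int a) (int i) = -1"
          using b(2) a(1) Legendre_cong [of "int a" "int b" "int i"] by (simp add: cong_int_iff)
        then have ai: "quadratic_character i a = -1" using 3 P48 by (auto simp: quadratic_character_def)
        have "\<not> i dvd a"
          using \<open>Legendre (int a) (int i) = -1\<close> by (auto simp: Legendre_def cong_0_iff split: if_splits)
        then have "coprime a i" using P(2) [OF 3] by (metis prime_imp_coprime coprime_commute)
        moreover have "coprime a 8" using cong_imp_coprime [OF cong_sym [OF a8]] by simp
        moreover have "M = 8 * (i * (\<Prod>p\<in>P-{i}. p))"
          unfolding M_def using prod.remove [OF P(1) 3, of "\<lambda>p. p"] by simp
        ultimately have "coprime a M" using cop1 [OF aR] by simp
        moreover have "quadratic_character j a = 1" if "j \<in> I - {i}" for j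
        proof -
          consider "j = 4" | "j = 8" | "j \<in> P - {i}" using \<open>j \<in> I - {i}\<close> by (auto simp: I_def)
          then show ?thesis
          proof cases
            case 3
            then show ?thesis using char1 [of j a] cong_prod [OF aR 3 Diff_subset] by simp
          next
            case 1
            have "a mod 4 = 1" using a8 mod_mod_cancel [of 4 8 a] by (simp add: cong_def)
            then show ?thesis using 1 by (simp add: quadratic_character_def chi4_def)
          next
            case 2
            then show ?thesis using a8 by (simp add: quadratic_character_def chi8_def cong_def)
          qed
        qed
        ultimately show ?thesis using ai by blast
      qed
    qed
    then obtain a where "coprime a M" "quadratic_character i a = -1"
      "\<forall>j\<in>I-{i}. quadratic_character j a = 1" by blast
    then show "\<exists>a. coprime a M \<and> real_of_int (quadratic_character i a) = -1 \<and>
        (\<forall>j\<in>I-{i}. real_of_int (quadratic_character j a) = 1)"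
      by (intro exI [of _ a]) simp
  qed
  then obtain q where q: "prime q" "q > K + M"
    "\<And>i. i \<in> I \<Longrightarrow> quadratic_character i q \<in> {0, \<epsilon> i}"
    by auto
  have M8: "M \<ge> 8" using prod_pos by (simp add: M_def)
  have "odd q" using q M8 by (intro prime_odd_nat) auto
  have "q mod 8 \<in> {1, 3, 5, 7}" using \<open>odd q\<close> by simp presburger
  moreover have "q mod 4 = 1"
  proof -
    have "q mod 4 = 1 \<or> q mod 4 = 3" using \<open>odd q\<close> by presburger
    then show ?thesis using q(3) [of 4] by (auto simp: I_def quadratic_character_def chi4_def \<epsilon>_def split: if_splits)
  qed
  moreover have "q mod 8 mod 4 = q mod 4" by (rule mod_mod_cancel) simp
  ultimately have "q mod 8 \<in> {1, 5}" by auto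
  then have "q mod 8 = s"
    using q(3) [of 8] s by (auto simp: I_def quadratic_character_def chi8_def \<epsilon>_def split: if_splits)
  moreover have "Legendre (int q) (int p) = \<delta> p" if p: "p \<in> P" for p
  proof -
    have "p dvd (\<Prod>p\<in>P. p)" using p P(1) by (intro dvd_prodI) auto
    then have "p \<le> M" using prod_pos dvd_imp_le [of p M] by (simp add: M_def)
    then have "\<not> p dvd q" using q P(2) [OF p] primes_dvd_imp_eq [of p q] by auto
    then have "Legendre (int q) (int p) \<noteq> 0"
      by (auto simp: Legendre_def cong_0_iff)
    then show ?thesis
      using q(3) [of p] p P48 by (auto simp: I_def quadratic_character_def \<epsilon>_def split: if_splits)
  qed
  ultimately show ?thesis using q by (intro that [of q]) auto
qed

section \<open>Quadratic residues and the Legendre equation\<close>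

lemma Legendre_minus_one:
  assumes "prime p" "p > 2"
  shows "Legendre (-1) (int p) = chi4 p"
proof (rule Legendre_eq_if_cong [OF _ _ _ assms(2)])
  show "Legendre (-1) (int p) \<in> {-1, 0, 1}" by (rule Legendre_cases)
  show "chi4 p \<in> {-1, 0, 1}" by (simp add: chi4_def)
  have "odd p" using assms by (simp add: prime_odd_nat)
  have "(-1) ^ ((p - 1) div 2) = chi4 p"
  proof (cases "p mod 4 = 1")
    case True
    then have "even ((p - 1) div 2)" by presburger
    then show ?thesis using True by (simp add: chi4_def)
  next
    case False
    then have "p mod 4 = 3" using \<open>odd p\<close> by presburger
    moreover from this have "odd ((p - 1) div 2)" by presburger
    ultimately show ?thesis by (simp add: chi4_def)
  qed
  then show "[Legendre (-1) (int p) = chi4 p] (mod int p)"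
    using euler_criterion [OF assms, of "-1"] by simp
qed

lemma Legendre_two:
  assumes "prime p" "p > 2"
  shows "Legendre 2 (int p) = chi8 p"
proof -
  interpret GAUSS p 2
  proof
    show "[2 \<noteq> 0] (mod int p)"
      using assms by (auto simp: cong_0_iff dest: zdvd_imp_le)
  qed (use assms in auto)
  define h where "h = (int p - 1) div 2"
  have ph: "int p = 2 * h + 1" using p_eq2 by (simp add: h_def)
  \<comment> \<open>As 2 x <= p - 1 for x <= h, reduction modulo p changes nothing. Gauss's lemma
    then counts the x with h div 2 < x <= h.\<close>
  have C: "C = (\<lambda>x. 2 * x) ` {0<..h}"
    unfolding C_def B_def A_def h_def [symmetric] image_image
    by (intro image_cong refl) (use ph in auto)
  have "E = (\<lambda>x. 2 * x) ` {h div 2<..h}"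
    unfolding E_def C h_def [symmetric] by auto
  then have "card E = card {h div 2<..h}"
    by (simp add: card_image inj_on_def)
  then have cardE: "card E = nat (h - h div 2)" by simp
  have h0: "h \<ge> 0" using ph by linarith
  have "odd p" using assms by (simp add: prime_odd_nat)
  then have "p mod 8 = 1 \<or> p mod 8 = 3 \<or> p mod 8 = 5 \<or> p mod 8 = 7" by presburger
  then have "(-1) ^ card E = chi8 p"
  proof (elim disjE)
    assume m: "p mod 8 = 1"
    then have "even (h - h div 2)" using ph by presburger
    then show ?thesis using h0 m by (simp add: cardE even_nat_iff chi8_def)
  next
    assume m: "p mod 8 = 3"
    then have "odd (h - h div 2)" using ph by presburger
    then show ?thesis using h0 m by (simp add: cardE even_nat_iff chi8_def)
  next
    assume m: "p mod 8 = 5"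
    then have "odd (h - h div 2)" using ph by presburger
    then show ?thesis using h0 m by (simp add: cardE even_nat_iff chi8_def)
  next
    assume m: "p mod 8 = 7"
    then have "even (h - h div 2)" using ph by presburger
    then show ?thesis using h0 m by (simp add: cardE even_nat_iff chi8_def)
  qed
  then show ?thesis using gauss_lemma by simp
qed

lemma Legendre_commute:
  assumes "prime p" "p > 2" "prime q" "q mod 4 = 1" "p \<noteq> q"
  shows "Legendre (int p) (int q) = Legendre (int q) (int p)"
proof -
  have q: "q > 2" using assms(3,4) prime_ge_2_nat [of q] by (cases "q = 2") auto
  have "even ((q - 1) div 2)" using assms(4) by presburger
  then have "Legendre (int p) (int q) * Legendre (int q) (int p) = 1"
    using Quadratic_Reciprocity [OF assms(1,2,3) q assms(5)] by simp
  then show ?thesis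
    using Legendre_cases [of "int p" "int q"] Legendre_cases [of "int q" "int p"] by auto
qed

lemma chi4_prod: "finite P \<Longrightarrow> chi4 (\<Prod>p\<in>P. p) = (\<Prod>p\<in>P. chi4 p)"
  by (induction P rule: finite_induct) (auto simp: chi4_mult, simp add: chi4_def)

lemma chi8_prod: "finite P \<Longrightarrow> chi8 (\<Prod>p\<in>P. p) = (\<Prod>p\<in>P. chi8 p)"
  by (induction P rule: finite_induct) (auto simp: chi8_mult, simp add: chi8_def)

lemma Legendre_prod:
  assumes "prime q" "q > 2" "finite P"
  shows "Legendre (int (\<Prod>p\<in>P. p)) (int q) = (\<Prod>p\<in>P. Legendre (int p) (int q))"
  using assms(3) by (induction P rule: finite_induct)
    (use assms in \<open>auto simp: Legendre_mult Legendre_one simp del: of_nat_prod\<close>)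

lemma QuadRes_mult_coprime:
  assumes "QuadRes m a" "QuadRes n a" "coprime m n"
  shows "QuadRes (m * n) a"
proof -
  obtain y z where y: "[y\<^sup>2 = a] (mod m)" and z: "[z\<^sup>2 = a] (mod n)"
    using assms by (auto simp: QuadRes_def)
  obtain x where x: "[x = y] (mod m)" "[x = z] (mod n)"
    using binary_chinese_remainder_int [OF assms(3)] by blast
  have "[x\<^sup>2 = a] (mod m)" using cong_trans [OF cong_pow [OF x(1)] y] .
  moreover have "[x\<^sup>2 = a] (mod n)" using cong_trans [OF cong_pow [OF x(2)] z] .
  ultimately have "[x\<^sup>2 = a] (mod m * n)" using assms(3) by (rule coprime_cong_mult)
  then show ?thesis by (auto simp: QuadRes_def)
qed

lemma QuadRes_prod_primes:
  assumes "finite P" "\<And>p. p \<in> P \<Longrightarrow> prime p" "\<And>p. p \<in> P \<Longrightarrow> QuadRes (int p) a"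
  shows "QuadRes (int (\<Prod>p\<in>P. p)) a"
  using assms
proof (induction P rule: finite_induct)
  case empty
  then show ?case by (simp add: QuadRes_def)
next
  case (insert p P)
  have "coprime p (\<Prod>p\<in>P. p)"
    using insert by (intro prod_coprime_right primes_coprime) auto
  then have "coprime (int p) (int (\<Prod>p\<in>P. p))" by (simp only: coprime_int_iff)
  then have "QuadRes (int p * int (\<Prod>p\<in>P. p)) a"
    using insert by (intro QuadRes_mult_coprime) auto
  then show ?case using insert.hyps by simp
qed

lemma QuadRes_two: "QuadRes 2 a"
  by (cases "even a") (auto simp: QuadRes_def cong_def odd_iff_mod_2_eq_one intro: exI [of _ 0] exI [of _ 1])

lemma Legendre_1_imp_QuadRes: "Legendre a p = 1 \<Longrightarrow> QuadRes p a"
  by (auto simp: Legendre_def split: if_splits)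

section \<open>Solutions of quadratic equations by the pigeonhole principle\<close>

lemma small_solution_of_congruences:
  fixes N D A B C :: nat and t s :: int
  assumes N: "N > 0" and D: "D > 0" and card: "N * D < (A + 1) * (B + 1) * (C + 1)"
  obtains x y w :: int where "x \<noteq> 0 \<or> y \<noteq> 0 \<or> w \<noteq> 0"
    "\<bar>x\<bar> \<le> int A" "\<bar>y\<bar> \<le> int B" "\<bar>w\<bar> \<le> int C" "[x = t * y] (mod int N)" "[x = s * w] (mod int D)"
proof -
  \<comment> \<open>Thue's argument with two moduli at once: the box X has more points than there
    are pairs of residues, and the difference of two colliding points is the solution.\<close>
  define X where "X = {0..int A} \<times> {0..int B} \<times> {0..int C}"
  define Y where "Y = {0..<int N} \<times> {0..<int D}"
  define \<phi> where "\<phi> = (\<lambda>(x, y, w). ((x - t * y) mod int N, (x - s * w) mod int D))"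
  have "card Y = N * D" by (simp add: Y_def card_cartesian_product)
  moreover have "card X = (A + 1) * (B + 1) * (C + 1)"
    by (simp add: X_def card_cartesian_product nat_add_distrib algebra_simps)
  ultimately have lt: "card Y < card X" using card by simp
  have "\<phi> ` X \<subseteq> Y" using N D by (auto simp: X_def Y_def \<phi>_def)
  then have "card (\<phi> ` X) \<le> card Y" by (intro card_mono) (auto simp: Y_def)
  with lt have "\<not> inj_on \<phi> X" using card_image [of \<phi> X] by auto
  then obtain u v where uv: "u \<in> X" "v \<in> X" "\<phi> u = \<phi> v" "u \<noteq> v" unfolding inj_on_def by blast
  obtain x1 y1 w1 x2 y2 w2 where e: "u = (x1, y1, w1)" "v = (x2, y2, w2)"
    by (cases u, cases v) auto
  show ?thesis
  proof (rule that [of "x1 - x2" "y1 - y2" "w1 - w2"])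
    show "x1 - x2 \<noteq> 0 \<or> y1 - y2 \<noteq> 0 \<or> w1 - w2 \<noteq> 0" using uv e by auto
    show "\<bar>x1 - x2\<bar> \<le> int A" "\<bar>y1 - y2\<bar> \<le> int B" "\<bar>w1 - w2\<bar> \<le> int C"
      using uv(1,2) unfolding e X_def by auto
    have "[x1 - t * y1 = x2 - t * y2] (mod int N)" "[x1 - s * w1 = x2 - s * w2] (mod int D)"
      using uv(3) unfolding e \<phi>_def by (auto simp: cong_def)
    then show "[x1 - x2 = t * (y1 - y2)] (mod int N)" "[x1 - x2 = s * (w1 - w2)] (mod int D)"
      by (auto simp: cong_iff_dvd_diff algebra_simps)
  qed
qed

lemma abs_le_floor_sqrt:
  fixes x :: int
  assumes "\<bar>x\<bar> \<le> int (floor_sqrt n)" shows "x\<^sup>2 \<le> int n"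
proof -
  have "x\<^sup>2 \<le> (int (floor_sqrt n))\<^sup>2" using assms by (metis abs_le_square_iff abs_of_nat)
  also have "\<dots> = int ((floor_sqrt n)\<^sup>2)" by simp
  also have "\<dots> \<le> int n" using floor_sqrt_power2_le [of n] by (simp only: of_nat_le_iff)
  finally show ?thesis .
qed

text \<open>A small solution of the congruences makes v = x^2 + D y^2 - N w^2 divisible by N and D,
  hence by N D. The box has sides about sqrt (N D), sqrt N and sqrt D, and as N and D are not
  squares, v lies strictly between -N D and 2 N D. So v is 0 or N D, and the second case is repaired
  by an identity.\<close>

lemma Legendre_equation_solvable:
  fixes N D :: nat
  assumes N0: "N > 0" and D0: "D > 0" and cop: "coprime N D"
    and N: "\<And>y :: int. y\<^sup>2 \<noteq> int N" and D: "\<And>y :: int. y\<^sup>2 \<noteq> int D"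
    and "QuadRes (int N) (- int D)" and "QuadRes (int D) (int N)"
  obtains x y w :: int where "w \<noteq> 0" "x\<^sup>2 + int D * y\<^sup>2 = int N * w\<^sup>2"
proof -
  obtain t s where t: "[t\<^sup>2 = - int D] (mod int N)" and s: "[s\<^sup>2 = int N] (mod int D)"
    using assms by (auto simp: QuadRes_def)
  define A B C where "A = floor_sqrt (N * D)" and "B = floor_sqrt N" and "C = floor_sqrt D"
  have lt: "N * D < (A + 1) * (B + 1) * (C + 1)"
  proof -
    have "(N * D) * (N * D) < (A + 1)\<^sup>2 * ((B + 1)\<^sup>2 * (C + 1)\<^sup>2)"
      using Suc_floor_sqrt_power2_gt [of "N * D"] Suc_floor_sqrt_power2_gt [of N] Suc_floor_sqrt_power2_gt [of D]
      unfolding A_def B_def C_def by (intro mult_strict_mono) auto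
    then have "(N * D)\<^sup>2 < ((A + 1) * (B + 1) * (C + 1))\<^sup>2"
      by (simp only: power2_eq_square mult_ac)
    then show ?thesis by (rule power2_less_imp_less) simp
  qed
  obtain x y w :: int where nz: "x \<noteq> 0 \<or> y \<noteq> 0 \<or> w \<noteq> 0"
    and b: "\<bar>x\<bar> \<le> int A" "\<bar>y\<bar> \<le> int B" "\<bar>w\<bar> \<le> int C"
    and xN: "[x = t * y] (mod int N)" and xD: "[x = s * w] (mod int D)"
    using small_solution_of_congruences [OF N0 D0 lt] by blast
  define v where "v = x\<^sup>2 + int D * y\<^sup>2 - int N * w\<^sup>2"
  have "int N dvd v"
  proof -
    have "[x\<^sup>2 = (t * y)\<^sup>2] (mod int N)" using xN by (rule cong_pow)
    also have "(t * y)\<^sup>2 = t\<^sup>2 * y\<^sup>2" by (rule power_mult_distrib)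
    also have "[t\<^sup>2 * y\<^sup>2 = - int D * y\<^sup>2] (mod int N)" using t by (rule cong_mult) simp
    finally have "int N dvd x\<^sup>2 - (- int D * y\<^sup>2)" by (simp add: cong_iff_dvd_diff)
    then have "int N dvd (x\<^sup>2 - (- int D * y\<^sup>2)) - int N * w\<^sup>2" by (rule dvd_diff) simp
    then show ?thesis by (simp add: v_def)
  qed
  moreover have "int D dvd v"
  proof -
    have "[x\<^sup>2 = (s * w)\<^sup>2] (mod int D)" using xD by (rule cong_pow)
    also have "(s * w)\<^sup>2 = s\<^sup>2 * w\<^sup>2" by (rule power_mult_distrib)
    also have "[s\<^sup>2 * w\<^sup>2 = int N * w\<^sup>2] (mod int D)" using s by (rule cong_mult) simp
    finally have "int D dvd x\<^sup>2 - int N * w\<^sup>2" by (simp add: cong_iff_dvd_diff)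
    then have "int D dvd (x\<^sup>2 - int N * w\<^sup>2) + int D * y\<^sup>2" by (rule dvd_add) simp
    then show ?thesis by (simp add: v_def algebra_simps)
  qed
  ultimately have "int N * int D dvd v" using cop by (intro divides_mult) auto
  then obtain k where k: "v = int N * int D * k" by auto
  have ND: "int N * int D > 0" using N0 D0 by simp
  have "x\<^sup>2 \<le> int N * int D" using abs_le_floor_sqrt [of x "N * D"] b(1) by (simp add: A_def)
  moreover have "int D * y\<^sup>2 < int N * int D"
    using abs_le_floor_sqrt [of y N] b(2) N [of y] D0 by (simp add: B_def)
  moreover have "int N * w\<^sup>2 < int N * int D"
    using abs_le_floor_sqrt [of w D] b(3) D [of w] N0 by (simp add: C_def)
  moreover have "0 \<le> x\<^sup>2" "0 \<le> int D * y\<^sup>2" "0 \<le> int N * w\<^sup>2" by auto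
  ultimately have "int N * int D * k < int N * int D * 2" "int N * int D * (-1) < int N * int D * k"
    unfolding k [symmetric] v_def by linarith+
  then have "k < 2" "-1 < k" using ND by (simp_all only: mult_less_cancel_left_pos)
  then consider "k = 0" | "k = 1" by linarith
  then show ?thesis
  proof cases
    case 1
    then have eq: "x\<^sup>2 + int D * y\<^sup>2 = int N * w\<^sup>2" using k by (simp add: v_def)
    have "w \<noteq> 0"
    proof
      assume "w = 0"
      then have "x\<^sup>2 + int D * y\<^sup>2 = 0" using eq by simp
      then have "x\<^sup>2 = 0 \<and> int D * y\<^sup>2 = 0"
        by (subst (asm) add_nonneg_eq_0_iff) auto
      then show False using nz D0 \<open>w = 0\<close> by auto
    qed
    then show ?thesis using eq that by blast
  next
    case 2
    then have "x\<^sup>2 + int D * y\<^sup>2 = int N * (w\<^sup>2 + int D)" using k by (simp add: v_def algebra_simps)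
    \<comment> \<open>Multiplicativity of the norm on Z[sqrt (-D)], for the product of x + y sqrt
      (-D) and w + sqrt (-D).\<close>
    then have "(x\<^sup>2 + int D * y\<^sup>2) * (w\<^sup>2 + int D) = int N * (w\<^sup>2 + int D)\<^sup>2"
      by (simp add: power2_eq_square)
    then have "(x * w - int D * y)\<^sup>2 + int D * (x + y * w)\<^sup>2 = int N * (w\<^sup>2 + int D)\<^sup>2"
      by (simp add: power2_eq_square algebra_simps)
    moreover have "w\<^sup>2 + int D \<noteq> 0" using add_nonneg_pos [of "w\<^sup>2" "int D"] D0 by simp
    ultimately show ?thesis using that by blast
  qed
qed

text \<open>Thue's argument with second modulus 1 and C = 0, which forces w = 0. It leaves x^2 + y^2
  as a multiple of q strictly between 0 and 2 q.\<close>

lemma prime_sum_two_squares: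
  assumes "prime q" "q mod 4 = 1"
  obtains a b :: int where "int q = a\<^sup>2 + b\<^sup>2"
proof -
  have q: "q > 2" using assms prime_ge_2_nat [of q] by (cases "q = 2") auto
  have "Legendre (-1) (int q) = 1" using Legendre_minus_one [OF assms(1) q] assms(2) by (simp add: chi4_def)
  then obtain t where t: "[t\<^sup>2 = -1] (mod int q)"
    using Legendre_1_imp_QuadRes by (auto simp: QuadRes_def)
  define A where "A = floor_sqrt q"
  have lt: "q * 1 < (A + 1) * (A + 1) * (0 + 1)"
    using Suc_floor_sqrt_power2_gt [of q] by (simp add: A_def power2_eq_square)
  obtain x y w :: int where xy: "x \<noteq> 0 \<or> y \<noteq> 0 \<or> w \<noteq> 0" "\<bar>x\<bar> \<le> int A" "\<bar>y\<bar> \<le> int A"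
      "\<bar>w\<bar> \<le> int 0" "[x = t * y] (mod int q)"
    using small_solution_of_congruences [OF _ _ lt, of t 0] q by auto
  have nonsq: "z\<^sup>2 \<noteq> int q" for z :: int
  proof
    assume "z\<^sup>2 = int q"
    then have "(nat \<bar>z\<bar>)\<^sup>2 = q" by (metis nat_int nat_power_eq abs_ge_zero power2_abs)
    then show False using assms(1) by (metis prime_power_iff numeral_eq_one_iff semiring_norm(85))
  qed
  have "[x\<^sup>2 = (t * y)\<^sup>2] (mod int q)" using xy(5) by (rule cong_pow)
  also have "(t * y)\<^sup>2 = t\<^sup>2 * y\<^sup>2" by (rule power_mult_distrib)
  also have "[t\<^sup>2 * y\<^sup>2 = -1 * y\<^sup>2] (mod int q)" using t by (rule cong_mult) simp
  finally have "int q dvd x\<^sup>2 + y\<^sup>2" by (simp add: cong_iff_dvd_diff)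
  then obtain k where k: "x\<^sup>2 + y\<^sup>2 = int q * k" by auto
  have "x\<^sup>2 < int q" "y\<^sup>2 < int q"
    using abs_le_floor_sqrt [of x q] abs_le_floor_sqrt [of y q] nonsq [of x] nonsq [of y] xy
    by (auto simp: A_def less_le)
  moreover have "x\<^sup>2 + y\<^sup>2 > 0" using xy by (auto simp: sum_power2_gt_zero_iff)
  ultimately have "int q * 0 < int q * k" "int q * k < int q * 2" using k by linarith+
  then have "0 < k" "k < 2" using q by (simp_all only: mult_less_cancel_left_pos of_nat_0_less_iff)
  then have "k = 1" by linarith
  then have "int q = x\<^sup>2 + y\<^sup>2" using k by simp
  then show ?thesis by (rule that)
qed

section \<open>The three-square theorem\<close>

lemma nearest_multiple:
  fixes x t :: int
  assumes "t > 0" obtains y where "2 * \<bar>t * y - x\<bar> \<le> t"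
proof -
  define y where "y = (2 * x + t) div (2 * t)"
  have "2 * x + t = 2 * t * y + (2 * x + t) mod (2 * t)" unfolding y_def by (rule mult_div_mod_eq [symmetric])
  then have "2 * x + t = 2 * (t * y) + (2 * x + t) mod (2 * t)" by (simp only: mult.assoc)
  moreover have "0 \<le> (2 * x + t) mod (2 * t)" "(2 * x + t) mod (2 * t) < 2 * t" using assms by auto
  moreover have "2 * \<bar>u - x\<bar> \<le> t" if "2 * x + t = 2 * u + r" "0 \<le> r" "r < 2 * t" for u r
  proof -
    have "2 * (u - x) \<le> t" "- (2 * (u - x)) \<le> t" using that by simp_all
    then show ?thesis by (simp add: abs_if)
  qed
  ultimately have "2 * \<bar>t * y - x\<bar> \<le> t" by blast
  then show ?thesis by (rule that)
qed

text \<open>Davenport and Cassels: the line through a rational point of the sphere and its nearest lattice point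
  meets the sphere in a second rational point, which has a smaller denominator.\<close>
lemma three_squares_if_rational:
  fixes N :: int
  assumes "t > 0" "N * t\<^sup>2 = x\<^sup>2 + y\<^sup>2 + z\<^sup>2"
  shows "\<exists>a b c :: int. N = a\<^sup>2 + b\<^sup>2 + c\<^sup>2"
  using assms
proof (induction "nat t" arbitrary: t x y z rule: less_induct)
  case less
  note t = \<open>t > 0\<close> and eq = \<open>N * t\<^sup>2 = x\<^sup>2 + y\<^sup>2 + z\<^sup>2\<close>
  obtain x' where x': "2 * \<bar>t * x' - x\<bar> \<le> t" using nearest_multiple [OF t] by blast
  obtain y' where y': "2 * \<bar>t * y' - y\<bar> \<le> t" using nearest_multiple [OF t] by blast
  obtain z' where z': "2 * \<bar>t * z' - z\<bar> \<le> t" using nearest_multiple [OF t] by blast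
  define r where "r = (t * x' - x)\<^sup>2 + (t * y' - y)\<^sup>2 + (t * z' - z)\<^sup>2"
  show ?case
  proof (cases "r = 0")
    case True
    then have "x = t * x'" "y = t * y'" "z = t * z'"
      by (auto simp: r_def add_nonneg_eq_0_iff)
    then have "t\<^sup>2 * N = t\<^sup>2 * (x'\<^sup>2 + y'\<^sup>2 + z'\<^sup>2)"
      using eq by (simp add: power_mult_distrib algebra_simps)
    then have "N = x'\<^sup>2 + y'\<^sup>2 + z'\<^sup>2" using t by simp
    then show ?thesis by blast
  next
    case False
    \<comment> \<open>The second intersection is the mean of the rational point, with weight a t,
      and the lattice point, with weight b. Its common denominator is t' = r / t.\<close>
    define a where "a = x'\<^sup>2 + y'\<^sup>2 + z'\<^sup>2 - N"
    define b where "b = 2 * (N * t - (x * x' + y * y' + z * z'))"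
    define t' where "t' = a * t + b"
    have "t * t' = t\<^sup>2 * (x'\<^sup>2 + y'\<^sup>2 + z'\<^sup>2) - 2 * t * (x * x' + y * y' + z * z') + N * t\<^sup>2"
      by (simp add: t'_def a_def b_def power2_eq_square algebra_simps)
    also have "\<dots> = r"
      unfolding eq r_def by (simp add: power2_eq_square algebra_simps)
    finally have tt': "t * t' = r" .
    have sq: "4 * u\<^sup>2 \<le> t\<^sup>2" if "2 * \<bar>u\<bar> \<le> t" for u :: int
    proof -
      have "(2 * \<bar>u\<bar>)\<^sup>2 \<le> t\<^sup>2" using that by (intro power_mono) auto
      then show ?thesis by (simp add: power_mult_distrib)
    qed
    have "r > 0" using False by (auto simp: r_def less_le)
    \<comment> \<open>Rounding three coordinates gives a squared distance of at most 3/4; that this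
      is below 1 makes the denominator shrink.\<close>
    have "4 * r \<le> 3 * t\<^sup>2" using sq [OF x'] sq [OF y'] sq [OF z'] by (simp add: r_def)
    moreover have "t\<^sup>2 > 0" using t by simp
    ultimately have "r < t\<^sup>2" by linarith
    then have "t * t' < t * t" by (simp add: tt' power2_eq_square)
    then have "t' < t" using t by simp
    have "t' > 0" using \<open>r > 0\<close> t unfolding tt' [symmetric] by (simp add: zero_less_mult_iff)
    have "(a * x + b * x')\<^sup>2 + (a * y + b * y')\<^sup>2 + (a * z + b * z')\<^sup>2 =
        a\<^sup>2 * (x\<^sup>2 + y\<^sup>2 + z\<^sup>2) + 2 * a * b * (x * x' + y * y' + z * z') + b\<^sup>2 * (x'\<^sup>2 + y'\<^sup>2 + z'\<^sup>2)"
      by (simp add: power2_eq_square algebra_simps)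
    also have "\<dots> = a\<^sup>2 * (N * t\<^sup>2) + a * b * (2 * N * t - b) + b\<^sup>2 * (a + N)"
      unfolding eq [symmetric] by (simp add: a_def b_def algebra_simps)
    also have "\<dots> = N * t'\<^sup>2"
      by (simp add: t'_def power2_eq_square algebra_simps)
    finally have "N * t'\<^sup>2 = (a * x + b * x')\<^sup>2 + (a * y + b * y')\<^sup>2 + (a * z + b * z')\<^sup>2" ..
    then show ?thesis using less.hyps [of t'] \<open>t' < t\<close> \<open>t' > 0\<close> by simp
  qed
qed

lemma squarefree_eq_prod_prime_factors:
  assumes "squarefree (N :: nat)" shows "(\<Prod>p\<in>prime_factors N. p) = N"
proof -
  have N: "N \<noteq> 0" using assms by (metis not_squarefree_0)
  have "N = (\<Prod>p\<in>prime_factors N. p ^ multiplicity p N)" using N by (intro prime_factorization_nat) auto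
  also have "\<dots> = (\<Prod>p\<in>prime_factors N. p)"
    using assms squarefree_factorial_semiring' [OF N] by (intro prod.cong) auto
  finally show ?thesis ..
qed

text \<open>The residue condition modulo N is assembled from its primes; at 2 it is automatic. For D
  = 2 q the oddness of N keeps N and D coprime, and D = (a + b)^2 + (a - b)^2 if q = a^2 +
  b^2.\<close>

lemma three_squares_if_Legendre:
  fixes N q D :: nat
  assumes N: "squarefree N" "N > 1" and q: "prime q" "q mod 4 = 1" "q > N"
    and D: "D = q \<or> D = 2 * q \<and> odd N"
    and QN: "\<And>p. p \<in> prime_factors N \<Longrightarrow> p > 2 \<Longrightarrow> Legendre (- int D) (int p) = 1"
    and Qq: "Legendre (int N) (int q) = 1"
  shows "\<exists>a b c :: int. int N = a\<^sup>2 + b\<^sup>2 + c\<^sup>2"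
proof -
  have q2: "q > 2" using q(1,2) prime_ge_2_nat [of q] by (cases "q = 2") auto
  have "\<not> q dvd N" using q(3) N(2) by (auto dest: dvd_imp_le)
  then have copq: "coprime N q" using q(1) by (metis prime_imp_coprime coprime_commute)
  have "coprime N D" using D copq by auto
  have "QuadRes (int p) (- int D)" if "p \<in> prime_factors N" for p
  proof (cases "p = 2")
    case True
    then show ?thesis using QuadRes_two by simp
  next
    case False
    have "p \<ge> 2" using that by (auto intro: prime_ge_2_nat)
    then show ?thesis using QN [OF that] False by (intro Legendre_1_imp_QuadRes) auto
  qed
  then have "QuadRes (int (\<Prod>p\<in>prime_factors N. p)) (- int D)"
    by (intro QuadRes_prod_primes) auto
  then have res1: "QuadRes (int N) (- int D)"
    using squarefree_eq_prod_prime_factors [OF N(1)] by simp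
  have resq: "QuadRes (int q) (int N)" using Qq by (rule Legendre_1_imp_QuadRes)
  have res2: "QuadRes (int D) (int N)"
    using D
  proof
    assume D2: "D = 2 * q \<and> odd N"
    have "odd q" using q(1) q2 by (simp add: prime_odd_nat)
    then have "coprime 2 (int q)" by simp
    then have "QuadRes (2 * int q) (int N)" by (rule QuadRes_mult_coprime [OF QuadRes_two resq])
    then show ?thesis using D2 by simp
  qed (use resq in simp)
  have Nsq: "y\<^sup>2 \<noteq> int N" for y :: int
  proof
    assume "y\<^sup>2 = int N"
    then have "int ((nat \<bar>y\<bar>)\<^sup>2) = int N" by simp
    then have y: "(nat \<bar>y\<bar>)\<^sup>2 = N" by (simp only: of_nat_eq_iff)
    then have "nat \<bar>y\<bar> dvd 1" using squarefreeD [OF N(1)] by (metis dvd_refl)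
    then show False using y N(2) by simp
  qed
  have Dsq: "y\<^sup>2 \<noteq> int D" for y :: int
  proof
    assume "y\<^sup>2 = int D"
    then have "int ((nat \<bar>y\<bar>)\<^sup>2) = int D" by simp
    then have y: "(nat \<bar>y\<bar>)\<^sup>2 = D" by (simp only: of_nat_eq_iff)
    have "q dvd D" using D by auto
    then have "q dvd nat \<bar>y\<bar>" using y q(1) by (metis prime_dvd_power_nat)
    then have "q\<^sup>2 dvd D" using y by (metis dvd_power_same)
    then have "q * q dvd 2 * q" using D by (auto simp: power2_eq_square intro: dvd_trans)
    then have "q dvd 2" using q2 by simp
    then show False using q2 by (auto dest: dvd_imp_le)
  qed
  have N0: "N > 0" and D0: "D > 0" using N(2) D q2 by auto
  obtain x y w :: int where w: "w \<noteq> 0" "x\<^sup>2 + int D * y\<^sup>2 = int N * w\<^sup>2"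
    using Legendre_equation_solvable [OF N0 D0 \<open>coprime N D\<close> Nsq Dsq res1 res2] by blast
  obtain a b :: int where ab: "int q = a\<^sup>2 + b\<^sup>2" using prime_sum_two_squares [OF q(1,2)] by blast
  obtain c d :: int where cd: "int D = c\<^sup>2 + d\<^sup>2"
  proof (cases "D = q")
    case True
    then show ?thesis using ab that by blast
  next
    case False
    then have "int D = (a + b)\<^sup>2 + (a - b)\<^sup>2"
      using D ab by (simp add: power2_eq_square algebra_simps)
    then show ?thesis by (rule that)
  qed
  have "int N * \<bar>w\<bar>\<^sup>2 = x\<^sup>2 + (c * y)\<^sup>2 + (d * y)\<^sup>2"
    using w(2) by (simp add: cd power_mult_distrib algebra_simps)
  then show ?thesis using w(1) by (intro three_squares_if_rational [of "\<bar>w\<bar>"]) auto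
qed

text \<open>Once (q/p) is chosen to make -D a residue modulo each odd p dividing N, the remaining
  condition (N/q) = 1 is computed by reciprocity. It reads \<open>chi4 N\<close> = 1 for D = q and N
  = 1 (mod 4), and \<open>chi4 N\<close> * \<open>chi8 N\<close> = 1 for D = 2 q and N = 3 (mod 8).
  For even N the class of q modulo 8 still has to adjust (2/q).\<close>

lemma three_squares_squarefree:
  assumes N: "squarefree N" "N mod 8 \<in> {1, 2, 3, 5, 6 :: nat}"
  shows "\<exists>a b c :: int. int N = a\<^sup>2 + b\<^sup>2 + c\<^sup>2"
proof (cases "N = 1")
  case True
  then show ?thesis by (intro exI [of _ 1] exI [of _ 0]) simp
next
  case False
  have "N \<noteq> 0" using N(1) by (metis not_squarefree_0)
  with False have N1: "N > 1" by simp
  define P where "P = prime_factors N - {2}"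
  have finP: "finite P" by (simp add: P_def)
  have P: "prime p \<and> p > 2" if "p \<in> P" for p
    using that prime_ge_2_nat [of p] by (auto simp: P_def in_prime_factors_iff le_less)
  have PN: "p \<in> P" if "p \<in> prime_factors N" "p > 2" for p using that by (auto simp: P_def)
  have chi: "chi4 p \<in> {-1, 1}" "chi8 p \<in> {-1, 1}" if "p \<in> P" for p
  proof -
    have "odd p" using P [OF that] by (simp add: prime_odd_nat)
    then have "p mod 4 = 1 \<or> p mod 4 = 3" "p mod 8 = 1 \<or> p mod 8 = 3 \<or> p mod 8 = 5 \<or> p mod 8 = 7"
      by presburger+
    then show "chi4 p \<in> {-1, 1}" "chi8 p \<in> {-1, 1}" by (auto simp: chi4_def chi8_def)
  qed
  have chi48: "chi4 p * chi8 p \<in> {-1, 1}" if "p \<in> P" for p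
    using chi [OF that] by auto
  have neq: "p \<noteq> q" if "p \<in> P" "q > N" for p q
    using that N1 by (auto simp: P_def in_prime_factors_iff dest: dvd_imp_le)
  have rec: "Legendre (int (\<Prod>p\<in>P. p)) (int q) = (\<Prod>p\<in>P. Legendre (int q) (int p))"
    if q: "prime q" "q mod 4 = 1" "q > N" for q
  proof -
    have "q > 2" using q(1,2) prime_ge_2_nat [of q] by (cases "q = 2") auto
    then have "Legendre (int (\<Prod>p\<in>P. p)) (int q) = (\<Prod>p\<in>P. Legendre (int p) (int q))"
      using q finP by (intro Legendre_prod)
    also have "\<dots> = (\<Prod>p\<in>P. Legendre (int q) (int p))"
      using P q neq by (intro prod.cong refl Legendre_commute) auto
    finally show ?thesis .
  qed
  have mod4: "q mod 4 = 1" if "q mod 8 = 1 \<or> q mod 8 = 5" for q :: nat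
    using that mod_mod_cancel [of 4 8 q] by auto
  have prodN: "(\<Prod>p\<in>prime_factors N. p) = N" using N(1) by (rule squarefree_eq_prod_prime_factors)
  show ?thesis
  proof (cases "even N")
    case False
    then have "P = prime_factors N" by (auto simp: P_def in_prime_factors_iff)
    then have prodP: "(\<Prod>p\<in>P. p) = N" using prodN by simp
    show ?thesis
    proof (cases "N mod 8 = 3")
      case True
      \<comment> \<open>For D = 2 q the condition (-2 q / p) = 1 amounts to (q/p) = (-1/p)
        (2/p).\<close>
      obtain q where q: "prime q" "q > N" "q mod 8 = 1"
        "\<And>p. p \<in> P \<Longrightarrow> Legendre (int q) (int p) = chi4 p * chi8 p"
        by (rule prime_with_prescribed_Legendre [of P "\<lambda>p. chi4 p * chi8 p" 1 N, OF finP P chi48]) auto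
      have q4: "q mod 4 = 1" using q(3) by (intro mod4) simp
      have "Legendre (int N) (int q) = (\<Prod>p\<in>P. chi4 p * chi8 p)"
        using rec [OF q(1) q4 q(2)] q(4) prodP by simp
      also have "\<dots> = chi4 N * chi8 N"
        using chi4_prod [OF finP] chi8_prod [OF finP] prodP by (simp add: prod.distrib)
      also have "\<dots> = 1" using True mod_mod_cancel [of 4 8 N] by (simp add: chi4_def chi8_def)
      finally have "Legendre (int N) (int q) = 1" .
      moreover have "Legendre (- int (2 * q)) (int p) = 1" if "p \<in> prime_factors N" "p > 2" for p
      proof -
        have p: "p \<in> P" using that by (rule PN)
        have "- int (2 * q) = (-1) * (2 * int q)" by simp
        then have "Legendre (- int (2 * q)) (int p) = chi4 p * (chi8 p * (chi4 p * chi8 p))"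
          using P [OF p] q(4) [OF p] by (simp only: Legendre_mult Legendre_minus_one Legendre_two)
        also have "\<dots> = 1" using chi [OF p] by auto
        finally show ?thesis .
      qed
      ultimately show ?thesis
        using False q q4 N N1 by (intro three_squares_if_Legendre [of N q "2 * q"]) auto
    next
      case F3: False
      moreover have "N mod 8 \<noteq> 2" "N mod 8 \<noteq> 6" using False by presburger+
      ultimately have N4: "N mod 4 = 1" using N(2) by (intro mod4) auto
      obtain q where q: "prime q" "q > N" "q mod 8 = 1"
        "\<And>p. p \<in> P \<Longrightarrow> Legendre (int q) (int p) = chi4 p"
        by (rule prime_with_prescribed_Legendre [of P chi4 1 N, OF finP P chi(1)]) auto
      have q4: "q mod 4 = 1" using q(3) by (intro mod4) simp
      have "Legendre (int N) (int q) = (\<Prod>p\<in>P. chi4 p)"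
        using rec [OF q(1) q4 q(2)] q(4) prodP by simp
      also have "\<dots> = chi4 N" using chi4_prod [OF finP] prodP by simp
      also have "\<dots> = 1" using N4 by (simp add: chi4_def)
      finally have "Legendre (int N) (int q) = 1" .
      moreover have "Legendre (- int q) (int p) = 1" if "p \<in> prime_factors N" "p > 2" for p
      proof -
        have p: "p \<in> P" using that by (rule PN)
        have "- int q = (-1) * int q" by simp
        then have "Legendre (- int q) (int p) = chi4 p * chi4 p"
          using P [OF p] q(4) [OF p] by (simp only: Legendre_mult Legendre_minus_one)
        also have "\<dots> = 1" using chi [OF p] by auto
        finally show ?thesis .
      qed
      ultimately show ?thesis
        using q q4 N N1 by (intro three_squares_if_Legendre [of N q q]) auto
    qed
  next
    case True
    define N' where "N' = (\<Prod>p\<in>P. p)"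
    have "2 \<in> prime_factors N" using True \<open>N \<noteq> 0\<close> by (auto simp: in_prime_factors_iff)
    then have N2: "N = 2 * N'"
      using prodN prod.remove [of "prime_factors N" 2 "\<lambda>p. p"] by (simp add: N'_def P_def)
    have "odd N'"
    proof
      assume "even N'"
      then have "2\<^sup>2 dvd N" unfolding N2 by (auto simp: power2_eq_square)
      then have "2 dvd (1::nat)" by (rule squarefreeD [OF N(1)])
      then show False by simp
    qed
    then have N'4: "N' mod 4 = 1 \<or> N' mod 4 = 3" by presburger
    \<comment> \<open>Choosing 5 instead of 1 modulo 8 flips (2/q) but keeps q = 1 (mod 4). Thus
      (2/q) matches (N'/q) = \<open>chi4 N'\<close>, and their product is 1.\<close>
    define s :: nat where "s = (if N' mod 4 = 1 then 1 else 5)"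
    obtain q where q: "prime q" "q > N" "q mod 8 = s"
      "\<And>p. p \<in> P \<Longrightarrow> Legendre (int q) (int p) = chi4 p"
      by (rule prime_with_prescribed_Legendre [of P chi4 s N, OF finP P chi(1)]) (auto simp: s_def)
    have q4: "q mod 4 = 1" using q(3) by (intro mod4) (auto simp: s_def)
    have q2: "q > 2" using q(1) q4 prime_ge_2_nat [of q] by (cases "q = 2") auto
    have "Legendre (int N') (int q) = chi4 N'"
      using rec [OF q(1) q4 q(2)] q(4) chi4_prod [OF finP] by (simp add: N'_def)
    moreover have "Legendre 2 (int q) = chi4 N'"
      using Legendre_two [OF q(1) q2] q(3) N'4 by (auto simp: chi8_def chi4_def s_def)
    moreover have "Legendre (int N) (int q) = Legendre 2 (int q) * Legendre (int N') (int q)"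
      unfolding N2 using Legendre_mult [OF q(1) q2] by simp
    ultimately have "Legendre (int N) (int q) = 1" using N'4 by (auto simp: chi4_def)
    moreover have "Legendre (- int q) (int p) = 1" if "p \<in> prime_factors N" "p > 2" for p
    proof -
      have p: "p \<in> P" using that by (rule PN)
      have "- int q = (-1) * int q" by simp
      then have "Legendre (- int q) (int p) = chi4 p * chi4 p"
        using P [OF p] q(4) [OF p] by (simp only: Legendre_mult Legendre_minus_one)
      also have "\<dots> = 1" using chi [OF p] by auto
      finally show ?thesis .
    qed
    ultimately show ?thesis
      using q q4 N N1 by (intro three_squares_if_Legendre [of N q q]) auto
  qed
qed

text \<open>As 4 does not divide N, its square factor k is odd. Then k^2 = 1 (mod 8), and the
  squarefree part lies in the same class modulo 8 as N.\<close>

theorem three_squares: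
  assumes N: "N mod 8 \<in> {1, 2, 3, 5, 6 :: nat}"
  shows "\<exists>a b c :: int. int N = a\<^sup>2 + b\<^sup>2 + c\<^sup>2"
proof -
  define k where "k = square_part N"
  define N' where "N' = squarefree_part N"
  have dec: "N = N' * k\<^sup>2" unfolding k_def N'_def by (rule squarefree_decompose)
  have "odd k"
  proof
    assume "even k"
    then obtain j where "k = 2 * j" by auto
    then have "N = 4 * (N' * j\<^sup>2)" using dec by (simp add: power_mult_distrib)
    then have "N mod 4 = 0" by simp
    then show False using N mod_mod_cancel [of 4 8 N] by auto
  qed
  then have "k mod 8 = 1 \<or> k mod 8 = 3 \<or> k mod 8 = 5 \<or> k mod 8 = 7" by presburger
  moreover have "k\<^sup>2 mod 8 = (k mod 8)\<^sup>2 mod 8" by (simp add: power_mod)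
  ultimately have "k\<^sup>2 mod 8 = 1" by auto
  then have "N mod 8 = N' mod 8"
    using mod_mult_right_eq [of N' "k\<^sup>2" 8] by (simp add: dec)
  then obtain a b c :: int where "int N' = a\<^sup>2 + b\<^sup>2 + c\<^sup>2"
    using three_squares_squarefree [of N'] N by (auto simp: N'_def)
  then have "int N = (a * int k)\<^sup>2 + (b * int k)\<^sup>2 + (c * int k)\<^sup>2"
    by (simp add: dec power_mult_distrib algebra_simps)
  then show ?thesis by blast
qed

section \<open>Mixed sums of squares and triangular numbers\<close>

lemma eisenstein_norm_eq:
  fixes u v :: int
  obtains c d where "u\<^sup>2 + u * v + v\<^sup>2 = c\<^sup>2 + 3 * d\<^sup>2"
proof -
  \<comment> \<open>One of u, v and u + v is even, and the form is symmetric in u, v and -(u + v).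
    Halving the even one completes the square.\<close>
  consider k where "u = 2 * k" | k where "v = 2 * k" | k where "u + v = 2 * k"
    by (metis evenE odd_even_add)
  then show ?thesis
  proof cases
    case (1 k)
    then have "u\<^sup>2 + u * v + v\<^sup>2 = (v + k)\<^sup>2 + 3 * k\<^sup>2" by (simp add: power2_eq_square algebra_simps)
    then show ?thesis by (rule that)
  next
    case (2 k)
    then have "u\<^sup>2 + u * v + v\<^sup>2 = (u + k)\<^sup>2 + 3 * k\<^sup>2" by (simp add: power2_eq_square algebra_simps)
    then show ?thesis by (rule that)
  next
    case (3 k)
    then have v: "v = 2 * k - u" by simp
    have "u\<^sup>2 + u * v + v\<^sup>2 = (u - k)\<^sup>2 + 3 * k\<^sup>2" unfolding v by (simp add: power2_eq_square algebra_simps)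
    then show ?thesis by (rule that)
  qed
qed

lemma sign_mod_3:
  fixes x :: int
  obtains y where "y\<^sup>2 = x\<^sup>2" "y mod 3 = 0 \<and> x\<^sup>2 mod 3 = 0 \<or> y mod 3 = 1 \<and> x\<^sup>2 mod 3 = 1"
proof -
  have sq: "x\<^sup>2 mod 3 = (x mod 3)\<^sup>2 mod 3" by (simp add: power_mod)
  have "x mod 3 = 0 \<or> x mod 3 = 1 \<or> x mod 3 = 2" by presburger
  then consider "x mod 3 = 0" | "x mod 3 = 1" | "x mod 3 = 2" by blast
  then show ?thesis
  proof cases
    case 3
    then have "(- x) mod 3 = 1" by presburger
    then show ?thesis using that [of "- x"] sq 3 by simp
  qed (use that [of x] sq in auto)
qed

text \<open>The lattice of all (X, Y, Z) with X = Y = Z (mod 3), scaled by 1/3, carries the form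
  x^2 + 2 (u^2 + u v + v^2), where 3 x = X + Y + Z, 3 u = X - Y and 3 v = Y - Z.\<close>
lemma form_1_2_6_if_three_squares:
  fixes m X Y Z :: int
  assumes "3 * m = X\<^sup>2 + Y\<^sup>2 + Z\<^sup>2"
  shows "\<exists>x y z :: int. m = x\<^sup>2 + 2 * y\<^sup>2 + 6 * z\<^sup>2"
proof -
  obtain A where A: "A\<^sup>2 = X\<^sup>2" "A mod 3 = 0 \<and> X\<^sup>2 mod 3 = 0 \<or> A mod 3 = 1 \<and> X\<^sup>2 mod 3 = 1" by (rule sign_mod_3)
  obtain B where B: "B\<^sup>2 = Y\<^sup>2" "B mod 3 = 0 \<and> Y\<^sup>2 mod 3 = 0 \<or> B mod 3 = 1 \<and> Y\<^sup>2 mod 3 = 1" by (rule sign_mod_3)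
  obtain C where C: "C\<^sup>2 = Z\<^sup>2" "C mod 3 = 0 \<and> Z\<^sup>2 mod 3 = 0 \<or> C mod 3 = 1 \<and> Z\<^sup>2 mod 3 = 1" by (rule sign_mod_3)
  define a b c where "a = X\<^sup>2" and "b = Y\<^sup>2" and "c = Z\<^sup>2"
  have abc: "3 * m = a + b + c" using assms by (simp add: a_def b_def c_def)
  \<comment> \<open>Three squares, each 0 or 1 modulo 3, have a sum divisible by 3 only if all are 0
    or all are 1; the signs were normalised so that the roots then agree.\<close>
  have "A mod 3 = B mod 3 \<and> B mod 3 = C mod 3"
    using A(2) B(2) C(2) abc unfolding a_def [symmetric] b_def [symmetric] c_def [symmetric]
    by (elim disjE conjE) (simp_all, presburger+)
  then obtain u v where uv: "A = B + 3 * u" "B = C + 3 * v"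
    by (metis mod_eqE mult.commute add_diff_cancel_left' diff_add_cancel mod_eq_dvd_iff dvdE add.commute)
  have "3 * m = A\<^sup>2 + B\<^sup>2 + C\<^sup>2" using assms A B C by simp
  then have "m = (C + 2 * v + u)\<^sup>2 + 2 * (u\<^sup>2 + u * v + v\<^sup>2)"
    unfolding uv by (simp add: power2_eq_square algebra_simps)
  moreover obtain c d where "u\<^sup>2 + u * v + v\<^sup>2 = c\<^sup>2 + 3 * d\<^sup>2" by (rule eisenstein_norm_eq)
  ultimately have "m = (C + 2 * v + u)\<^sup>2 + 2 * c\<^sup>2 + 6 * d\<^sup>2" by simp
  then show ?thesis by blast
qed

text \<open>Multiplication by 3 sends these classes modulo 8 to 3, 6, 1, 2 and 5. The class 5 is
  missing because 15 = 7 (mod 8).\<close>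

lemma form_1_2_6:
  assumes "m mod 8 \<in> {1, 2, 3, 6, 7 :: nat}"
  obtains x y z :: int where "int m = x\<^sup>2 + 2 * y\<^sup>2 + 6 * z\<^sup>2"
proof -
  have "3 * m mod 8 = 3 * (m mod 8) mod 8" by (simp add: mod_mult_right_eq)
  then have "3 * m mod 8 \<in> {1, 2, 3, 5, 6}" using assms by auto
  then obtain a b c :: int where "int (3 * m) = a\<^sup>2 + b\<^sup>2 + c\<^sup>2" using three_squares by blast
  then have "3 * int m = a\<^sup>2 + b\<^sup>2 + c\<^sup>2" by simp
  then show ?thesis using form_1_2_6_if_three_squares that by blast
qed

section \<open>The four forms obtained from x^2 + 2 y^2 + 6 z^2\<close>

lemma odd_square_eq_tri:
  fixes x :: int
  assumes "odd x" obtains z where "x\<^sup>2 = 8 * tri z + 1"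
proof -
  obtain z where z: "x = 2 * z + 1" using assms by (elim oddE)
  have "2 * tri z = z * (z + 1)" by (simp add: tri_def)
  then have "x\<^sup>2 = 8 * tri z + 1" by (simp add: z power2_eq_square algebra_simps)
  then show ?thesis by (rule that)
qed

lemma square_mod_4:
  fixes y :: int
  shows "even y \<Longrightarrow> y\<^sup>2 mod 4 = 0" "odd y \<Longrightarrow> y\<^sup>2 mod 4 = 1"
proof -
  show "y\<^sup>2 mod 4 = 0" if "even y" using that by (auto elim!: evenE simp: power_mult_distrib)
  show "y\<^sup>2 mod 4 = 1" if y: "odd y"
  proof -
    obtain t where "y\<^sup>2 = 8 * tri t + 1" using y by (rule odd_square_eq_tri)
    then show ?thesis by presburger
  qed
qed

text \<open>Modulo 4 the sum y^2 + 3 z^2 is 3 only for y even and z odd, 1 only for y odd and z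
  even, and 0 when the parities agree.\<close>

lemma parity_if_sum_cong_3:
  fixes y z k :: int
  assumes "y\<^sup>2 + 3 * z\<^sup>2 = 4 * k + 3" shows "even y" "odd z"
proof -
  define a b where "a = y\<^sup>2" and "b = z\<^sup>2"
  have eq: "a + 3 * b = 4 * k + 3" using assms by (simp add: a_def b_def)
  have "even y \<and> odd z"
  proof (cases "even y"; cases "even z")
    assume "even y" "even z"
    then have "a mod 4 = 0" "b mod 4 = 0" by (simp_all add: a_def b_def square_mod_4)
    then show ?thesis using eq by presburger
  next
    assume "odd y" "even z"
    then have "a mod 4 = 1" "b mod 4 = 0" by (simp_all add: a_def b_def square_mod_4)
    then show ?thesis using eq by presburger
  next
    assume "odd y" "odd z"
    then have "a mod 4 = 1" "b mod 4 = 1" by (simp_all add: a_def b_def square_mod_4)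
    then show ?thesis using eq by presburger
  qed auto
  then show "even y" "odd z" by auto
qed

lemma parity_if_sum_cong_1:
  fixes y z k :: int
  assumes "y\<^sup>2 + 3 * z\<^sup>2 = 4 * k + 1" shows "odd y" "even z"
proof -
  define a b where "a = y\<^sup>2" and "b = z\<^sup>2"
  have eq: "a + 3 * b = 4 * k + 1" using assms by (simp add: a_def b_def)
  have "odd y \<and> even z"
  proof (cases "even y"; cases "even z")
    assume "even y" "even z"
    then have "a mod 4 = 0" "b mod 4 = 0" by (simp_all add: a_def b_def square_mod_4)
    then show ?thesis using eq by presburger
  next
    assume "even y" "odd z"
    then have "a mod 4 = 0" "b mod 4 = 1" by (simp_all add: a_def b_def square_mod_4)
    then show ?thesis using eq by presburger
  next
    assume "odd y" "odd z"
    then have "a mod 4 = 1" "b mod 4 = 1" by (simp_all add: a_def b_def square_mod_4)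
    then show ?thesis using eq by presburger
  qed auto
  then show "odd y" "even z" by auto
qed

text \<open>In 8 n + 1 = x^2 + 2 y^2 + 6 z^2 the roots y and z have equal parity but may both be
  odd. Dividing y^2 + 3 z^2 by 4 therefore gives u^2 + u z + z^2, which is again a square plus three
  times a square.\<close>

lemma square_plus_3_square_plus_tri: "\<exists>x y z. int n = x\<^sup>2 + 3 * y\<^sup>2 + tri z"
proof -
  have "(8 * n + 1) mod 8 \<in> {1, 2, 3, 6, 7}" by simp
  then obtain x y z :: int where "int (8 * n + 1) = x\<^sup>2 + 2 * y\<^sup>2 + 6 * z\<^sup>2" by (rule form_1_2_6)
  then have eq: "8 * int n + 1 = x\<^sup>2 + 2 * y\<^sup>2 + 6 * z\<^sup>2" by simp
  have "odd (x\<^sup>2 + 2 * y\<^sup>2 + 6 * z\<^sup>2)" unfolding eq [symmetric] by simp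
  then have "odd x" by simp
  then obtain t where t: "x\<^sup>2 = 8 * tri t + 1" by (rule odd_square_eq_tri)
  have yz: "y\<^sup>2 + 3 * z\<^sup>2 = 4 * (int n - tri t)" using eq t by simp
  have "even (y\<^sup>2 + 3 * z\<^sup>2)" unfolding yz by simp
  then have "even (y - z)" by simp
  then obtain u where u: "y = z + 2 * u" by (metis evenE add.commute diff_add_cancel)
  have "int n - tri t = u\<^sup>2 + u * z + z\<^sup>2" using yz unfolding u by (simp add: power2_eq_square algebra_simps)
  moreover obtain c d where "u\<^sup>2 + u * z + z\<^sup>2 = c\<^sup>2 + 3 * d\<^sup>2" by (rule eisenstein_norm_eq)
  ultimately have "int n = c\<^sup>2 + 3 * d\<^sup>2 + tri t" by simp
  then show ?thesis by blast
qed

text \<open>Completing squares asks for 8 n + 4 = 8 x^2 + 3 b^2 + a^2 with a and b odd. Multiplying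
  y^2 + 3 z^2 by 4 as a norm, that is by 1 - sqrt (-3), replaces y and z of opposite parity by the
  odd numbers y + 3 z and y - z, up to sign.\<close>

lemma square_plus_3_tri_plus_tri: "\<exists>x y z. int n = x\<^sup>2 + 3 * tri y + tri z"
proof -
  have "(4 * n + 2) mod 8 = 2 \<or> (4 * n + 2) mod 8 = 6" by presburger
  then have "(4 * n + 2) mod 8 \<in> {1, 2, 3, 6, 7}" by auto
  then obtain x y z :: int where "int (4 * n + 2) = x\<^sup>2 + 2 * y\<^sup>2 + 6 * z\<^sup>2" by (rule form_1_2_6)
  then have eq: "4 * int n + 2 = x\<^sup>2 + 2 * y\<^sup>2 + 6 * z\<^sup>2" by simp
  have "even (x\<^sup>2 + 2 * y\<^sup>2 + 6 * z\<^sup>2)" unfolding eq [symmetric] by simp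
  then have "even x" by simp
  then obtain w where w: "x = 2 * w" by (rule evenE)
  have yz: "y\<^sup>2 + 3 * z\<^sup>2 = 2 * (int n - w\<^sup>2) + 1" using eq by (simp add: w power_mult_distrib)
  have "odd (y\<^sup>2 + 3 * z\<^sup>2)" unfolding yz by simp
  then have "odd (y + 3 * z)" "odd (y - z)" by auto
  then obtain a b where a: "(y + 3 * z)\<^sup>2 = 8 * tri a + 1" and b: "(y - z)\<^sup>2 = 8 * tri b + 1"
    by (metis odd_square_eq_tri)
  have "(y + 3 * z)\<^sup>2 + 3 * (y - z)\<^sup>2 = 4 * (y\<^sup>2 + 3 * z\<^sup>2)" by (simp add: power2_eq_square algebra_simps)
  then have "int n = w\<^sup>2 + 3 * tri b + tri a" using yz unfolding a b by simp
  then show ?thesis by blast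
qed

text \<open>For 8 n + 7 parity forces x odd, y even and z odd, which is the shape of the completed
  squares. The next form uses 8 n + 3, which forces x and y odd and z even.\<close>

lemma square_plus_6_tri_plus_tri: "\<exists>x y z. int n = x\<^sup>2 + 6 * tri y + tri z"
proof -
  have "(8 * n + 7) mod 8 \<in> {1, 2, 3, 6, 7}" by simp
  then obtain x y z :: int where "int (8 * n + 7) = x\<^sup>2 + 2 * y\<^sup>2 + 6 * z\<^sup>2" by (rule form_1_2_6)
  then have eq: "8 * int n + 7 = x\<^sup>2 + 2 * y\<^sup>2 + 6 * z\<^sup>2" by simp
  have "odd (x\<^sup>2 + 2 * y\<^sup>2 + 6 * z\<^sup>2)" unfolding eq [symmetric] by simp
  then have "odd x" by simp
  then obtain t where t: "x\<^sup>2 = 8 * tri t + 1" by (rule odd_square_eq_tri)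
  have yz: "y\<^sup>2 + 3 * z\<^sup>2 = 4 * (int n - tri t) + 3" using eq t by simp
  obtain w where w: "y = 2 * w" using parity_if_sum_cong_3(1) [OF yz] by (rule evenE)
  obtain s where s: "z\<^sup>2 = 8 * tri s + 1" using parity_if_sum_cong_3(2) [OF yz] by (rule odd_square_eq_tri)
  have "int n = w\<^sup>2 + 6 * tri s + tri t" using yz unfolding s w by (simp add: power_mult_distrib)
  then show ?thesis by blast
qed

lemma three_square_plus_2_tri_plus_tri: "\<exists>x y z. int n = 3 * x\<^sup>2 + 2 * tri y + tri z"
proof -
  have "(8 * n + 3) mod 8 \<in> {1, 2, 3, 6, 7}" by simp
  then obtain x y z :: int where "int (8 * n + 3) = x\<^sup>2 + 2 * y\<^sup>2 + 6 * z\<^sup>2" by (rule form_1_2_6)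
  then have eq: "8 * int n + 3 = x\<^sup>2 + 2 * y\<^sup>2 + 6 * z\<^sup>2" by simp
  have "odd (x\<^sup>2 + 2 * y\<^sup>2 + 6 * z\<^sup>2)" unfolding eq [symmetric] by simp
  then have "odd x" by simp
  then obtain t where t: "x\<^sup>2 = 8 * tri t + 1" by (rule odd_square_eq_tri)
  have yz: "y\<^sup>2 + 3 * z\<^sup>2 = 4 * (int n - tri t) + 1" using eq t by simp
  obtain w where w: "z = 2 * w" using parity_if_sum_cong_1(2) [OF yz] by (rule evenE)
  obtain s where s: "y\<^sup>2 = 8 * tri s + 1" using parity_if_sum_cong_1(1) [OF yz] by (rule odd_square_eq_tri)
  have "int n = 3 * w\<^sup>2 + 2 * tri s + tri t" using yz unfolding s w by (simp add: power_mult_distrib)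
  then show ?thesis by blast
qed

section \<open>The form 4 x^2 + 2 t_y + t_z\<close>

lemma sign_mod_8:
  fixes x :: int
  assumes "odd x"
  obtains y where "y\<^sup>2 = x\<^sup>2" "odd y" "y mod 8 = 1 \<or> y mod 8 = 3"
proof -
  have "(x mod 8 = 1 \<or> x mod 8 = 3) \<or> ((- x) mod 8 = 1 \<or> (- x) mod 8 = 3)"
    using assms by presburger
  then consider "x mod 8 = 1 \<or> x mod 8 = 3" | "(- x) mod 8 = 1 \<or> (- x) mod 8 = 3" by blast
  then show ?thesis using that [of x] that [of "- x"] assms by cases auto
qed

text \<open>If a = b + 8 x, then a and b lie at distance 4 x from their odd mean, so a^2 + b^2 is
  twice the square of the mean plus 32 x^2. Division by 8 turns the latter into 4 x^2.\<close>

lemma four_square_plus_2_tri_plus_tri_if_cong: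
  fixes a b c :: int
  assumes "8 * m + 3 = a\<^sup>2 + b\<^sup>2 + c\<^sup>2" "odd a" "odd c" "a mod 8 = b mod 8"
  shows "\<exists>x y z. m = 4 * x\<^sup>2 + 2 * tri y + tri z"
proof -
  obtain x where x: "a = b + 8 * x" using assms(4) by (metis mod_eq_dvd_iff dvdE diff_add_cancel add.commute)
  have "odd (b + 4 * x)" using assms(2) by (simp add: x)
  then obtain s where s: "(b + 4 * x)\<^sup>2 = 8 * tri s + 1" by (rule odd_square_eq_tri)
  obtain t where t: "c\<^sup>2 = 8 * tri t + 1" using assms(3) by (rule odd_square_eq_tri)
  have "a\<^sup>2 + b\<^sup>2 = 2 * (b + 4 * x)\<^sup>2 + 32 * x\<^sup>2" by (simp add: x power2_eq_square algebra_simps)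
  then have "m = 4 * x\<^sup>2 + 2 * tri s + tri t" using assms(1) s t by simp
  then show ?thesis by blast
qed

lemma four_square_plus_2_tri_plus_tri: "\<exists>x y z. int n = 4 * x\<^sup>2 + 2 * tri y + tri z"
proof -
  have "(8 * n + 3) mod 8 \<in> {1, 2, 3, 5, 6}" by simp
  then obtain a b c :: int where "int (8 * n + 3) = a\<^sup>2 + b\<^sup>2 + c\<^sup>2" using three_squares by blast
  then have eq: "8 * int n + 3 = a\<^sup>2 + b\<^sup>2 + c\<^sup>2" by simp
  define p q r where "p = a\<^sup>2" and "q = b\<^sup>2" and "r = c\<^sup>2"
  have pqr: "p mod 4 = (if even a then 0 else 1)" "q mod 4 = (if even b then 0 else 1)" "r mod 4 = (if even c then 0 else 1)"
    by (simp_all add: p_def q_def r_def square_mod_4)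
  have "8 * int n + 3 = p + q + r" using eq by (simp add: p_def q_def r_def)
  then have "(p mod 4 + q mod 4 + r mod 4) mod 4 = 3" by presburger
  then have "odd a" "odd b" "odd c" unfolding pqr by (auto split: if_splits)
  obtain a' where a': "a'\<^sup>2 = a\<^sup>2" "odd a'" "a' mod 8 = 1 \<or> a' mod 8 = 3" using \<open>odd a\<close> by (rule sign_mod_8)
  obtain b' where b': "b'\<^sup>2 = b\<^sup>2" "odd b'" "b' mod 8 = 1 \<or> b' mod 8 = 3" using \<open>odd b\<close> by (rule sign_mod_8)
  obtain c' where c': "c'\<^sup>2 = c\<^sup>2" "odd c'" "c' mod 8 = 1 \<or> c' mod 8 = 3" using \<open>odd c\<close> by (rule sign_mod_8)
  \<comment> \<open>Three roots share the two classes 1 and 3, so two of them agree modulo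
    8.\<close>
  consider "a' mod 8 = b' mod 8" | "b' mod 8 = c' mod 8" | "a' mod 8 = c' mod 8"
    using a'(3) b'(3) c'(3) by metis
  then show ?thesis
  proof cases
    case 1
    then show ?thesis
      using eq a' b' c' by (intro four_square_plus_2_tri_plus_tri_if_cong [of _ a' b' c']) auto
  next
    case 2
    then show ?thesis
      using eq a' b' c' by (intro four_square_plus_2_tri_plus_tri_if_cong [of _ b' c' a']) auto
  next
    case 3
    then show ?thesis
      using eq a' b' c' by (intro four_square_plus_2_tri_plus_tri_if_cong [of _ a' c' b']) auto
  qed
qed

theorem theorem2:
  fixes n :: nat
  shows "(\<exists>x y z :: int. int n = x^2 + 3 * y^2 + tri z)
       \<and> (\<exists>x y z :: int. int n = x^2 + 3 * tri y + tri z)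
       \<and> (\<exists>x y z :: int. int n = x^2 + 6 * tri y + tri z)
       \<and> (\<exists>x y z :: int. int n = 3 * x^2 + 2 * tri y + tri z)
       \<and> (\<exists>x y z :: int. int n = 4 * x^2 + 2 * tri y + tri z)"
  by (intro conjI square_plus_3_square_plus_tri square_plus_3_tri_plus_tri
      square_plus_6_tri_plus_tri three_square_plus_2_tri_plus_tri four_square_plus_2_tri_plus_tri)

end
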